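(* Let $S_\tau=\{(W,\mathcal W),(X,\mathcal X),u,P,\{\Gamma_x\}_{x\in X}\}$ be a polynomial RSCC satisfying the standing assumptions, and assume that $\Gamma_x$ is a compact subset of $\mathrm{Poly}_+$ for each $x\in X$. Then, for every state $w\in W$, the zero set of the statewise escaping probability agrees with the smallest filled-in Julia set at $w$: $$K_w(S_\tau)=\{z\in\widehat{\mathbb C}: T_{\infty,\tilde\tau_w}(z)=0\}.$$
   Context: **RSCC.** A random system with complete connections (RSCC) is a quadruple $\{(W,\mathcal W),(X,\mathcal X),u,P\}$ where $(W,\mathcal W)$ (state space) and $(X,\mathcal X)$ (index space) are measurable spaces, $u\colon W\times X\to W$ (update map) is measurable, and $P$ is a transition probability function from $(W,\mathcal W)$ to $(X,\mathcal X)$. Write $wx:=u(w,x)$ and, inductively, $wx^{(n)}:=u(wx^{(n-1)},x_n)$ for $x^{(n)}=(x_1,\dots,x_n)\in X^n$, where $x^{(n-1)}=(x_1,\dots,x_{n-1})$. The induced Markov kernel on $W$ is $Q(w,A):=\int_X\mathbf 1_A(u(w,x))\,P(w,dx)$, with operator $(\mathbf Uf)(w):=\int_W f(w')\,Q(w,dw')$. **Standing assumptions.** $X$ is finite and discrete, $\mathcal X$ is its power set; $W$ is a compact metric space and $\mathcal W=\mathcal B(W)$ is its Borel $\sigma$-algebra; for each $x\in X$ the map $v\mapsto P(v,\{x\})$ is continuous on $W$; the kernel $Q$ is continuous, i.e. $\mathbf U$ maps $C(W)$ into $C(W)$. **Polynomial RSCC.** $\widehat{\mathbb C}$ is the Riemann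 sphere with spherical metric $d_{\widehat{\mathbb C}}$. $\mathrm{Poly}$ is the set of non-constant polynomial maps $\widehat{\mathbb C}\to\widehat{\mathbb C}$ with metric $\sup_z d_{\widehat{\mathbb C}}(f(z),g(z))$, and $\mathrm{Poly}_+=\{h\in\mathrm{Poly}:\deg h\ge2\}$. For each $x\in X$ a Borel probability measure $\tau_x$ on $\mathrm{Poly}$ is fixed and $\Gamma_x:=\operatorname{supp}\tau_x\subset\mathrm{Poly}$. The resulting system $S_\tau=\{(W,\mathcal W),(X,\mathcal X),u,P,\{\Gamma_x\}_{x\in X}\}$ is called a polynomial RSCC. **Admissible words and paths.** For $w\in W$, $\mathbf P_w$ is the unique probability measure on $X^{\mathbb N}$ with $\mathbf P_w([x_1,\dots,x_n])=P(w,\{x_1\})P(wx_1,\{x_2\})\cdots P(wx^{(n-1)},\{x_n\})$ on cylinders. Let $X_{w,n}:=\{x^{(n)}\in X^n:\mathbf P_w([x^{(n)}])>0\}$. Let $$H_w(S_\tau):=\{\gamma_n\circ\cdots\circ\gamma_1: n\in\mathbb N,\ x^{(n)}\in X_{w,n},\ \gamma_j\in\Gamma_{x_j}\ (1\le j\le n)\},$$ $$\Xi_w(S_\tau):=\{(\gamma_n,x_n)_{n\in\mathbb N}\in(\mathrm{Poly}\times X)^{\mathbb N}:(x_n)\in\operatorname{supp}\mathbf P_w,\ \gamma_n\in\Gamma_{x_n}\ \forall n\}.$$ $\tilde\tau_w$ is the probability measure on $\Xi_w(S_\tau)$ (with the $\sigma$-algebra generated by cylinders) determined by: the set of all $(\gamma_k,x'_k)_k\in\Xi_w(S_\tau)$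 with $x'_k=x_k$ and $\gamma_k\in A_k$ for $1\le k\le n$ has measure $\mathbf P_w([x_1,\dots,x_n])\prod_{k=1}^n\tau_{x_k}(A_k)$, for $x^{(n)}\in X_{w,n}$ and Borel $A_k\subset\Gamma_{x_k}$. Write $\gamma_{n,1}:=\gamma_n\circ\cdots\circ\gamma_1$. **Escaping probability.** $T_{\infty,\tilde\tau_w}(z):=\tilde\tau_w(\{(\gamma_n,x_n)_n\in\Xi_w(S_\tau):\gamma_{n,1}(z)\to\infty\text{ in }\widehat{\mathbb C}\text{ as }n\to\infty\})$. **Smallest filled-in Julia set at $w$.** $K_w(S_\tau):=\{z\in\widehat{\mathbb C}:\{\gamma(z):\gamma\in H_w(S_\tau)\}\text{ is bounded in }\mathbb C\}$ (in particular this set of images must be contained in $\mathbb C$). *)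

theory Defs
  imports "HOL-Probability.Probability" "HOL-Computational_Algebra.Polynomial"
begin

section \<open>The Riemann sphere with its spherical metric\<close>

datatype rsphere = Fin complex | Infty

text \<open>The metric is the great-circle distance on the unit sphere of \<open>\<complex> \<times> \<real>\<close>,
  transported by (inverse) stereographic projection.\<close>

fun stereo :: "rsphere \<Rightarrow> complex \<times> real" where
  "stereo (Fin z) = ((2 / (1 + (cmod z)\<^sup>2)) *\<^sub>R z, ((cmod z)\<^sup>2 - 1) / ((cmod z)\<^sup>2 + 1))"
| "stereo Infty = (0, 1)"

lemma inner_stereo_self: "stereo z \<bullet> stereo z = 1"
proof (cases z)
  case (Fin c)
  define r where "r = (cmod c)\<^sup>2"
  have r: "1 + r > 0" unfolding r_def by (simp add: add_pos_nonneg)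
  have "stereo z \<bullet> stereo z = (2 / (1 + r))\<^sup>2 * r + ((r - 1) / (r + 1))\<^sup>2"
    using dot_square_norm[of c]
    by (simp add: Fin r_def inner_prod_def power2_eq_square add.commute)
  also have "\<dots> = (4 * r + (r - 1)\<^sup>2) / (1 + r)\<^sup>2"
    using r by (simp add: power_divide add_divide_distrib add.commute)
  also have "4 * r + (r - 1)\<^sup>2 = (1 + r)\<^sup>2" by (simp add: power2_eq_square algebra_simps)
  finally show ?thesis using r by simp
qed (simp add: inner_prod_def)

lemma norm_stereo [simp]: "norm (stereo z) = 1"
  by (simp add: norm_eq_sqrt_inner inner_stereo_self)

lemma inj_stereo: "stereo z = stereo w \<Longrightarrow> z = w"
proof -
  have aux: "(s - 1) / (s + 1) = (r - 1) / (r + 1) \<Longrightarrow> s = r" if "s \<ge> 0" "r \<ge> 0" for r s :: real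
    using that by (simp add: field_simps)
  have aux1: "(s - 1) / (s + 1) \<noteq> 1" if "s \<ge> 0" for s :: real
    using that by (simp add: field_simps)
  assume eq: "stereo z = stereo w"
  show "z = w"
  proof (cases z; cases w)
    fix a b assume ab: "z = Fin a" "w = Fin b"
    have "((cmod a)\<^sup>2 - 1) / ((cmod a)\<^sup>2 + 1) = ((cmod b)\<^sup>2 - 1) / ((cmod b)\<^sup>2 + 1)"
      using arg_cong[OF eq, of snd] ab by simp
    then have "(cmod a)\<^sup>2 = (cmod b)\<^sup>2"
      by (rule aux[OF zero_le_power2 zero_le_power2])
    moreover have "1 + (cmod b)\<^sup>2 \<noteq> 0"
      using zero_le_power2[of "cmod b"] by linarith
    ultimately show "z = w"
      using arg_cong[OF eq, of fst] ab by simp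
  next
    fix a assume "z = Fin a" "w = Infty" then show "z = w"
      using eq aux1[of "(cmod a)\<^sup>2"] by simp
  next
    fix a assume "z = Infty" "w = Fin a" then show "z = w"
      using eq aux1[of "(cmod a)\<^sup>2"] by simp
  qed auto
qed

lemma inner_unit_bounds:
  fixes x y :: "'a::real_inner"
  assumes "norm x = 1" "norm y = 1"
  shows "-1 \<le> x \<bullet> y" "x \<bullet> y \<le> 1"
  using Cauchy_Schwarz_ineq2[of x y] assms by auto

lemma angle_triangle:
  fixes x y z :: "'a::real_inner"
  assumes n: "norm x = 1" "norm y = 1" "norm z = 1"
  shows "arccos (x \<bullet> z) \<le> arccos (x \<bullet> y) + arccos (y \<bullet> z)"
proof -
  define a b where "a = x \<bullet> y" and "b = y \<bullet> z"
  have ab: "-1 \<le> a" "a \<le> 1" "-1 \<le> b" "b \<le> 1"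
    unfolding a_def b_def using inner_unit_bounds n by auto
  have sq: "x \<bullet> x = 1" "y \<bullet> y = 1" "z \<bullet> z = 1"
    using n by (simp_all add: dot_square_norm)
  have na: "norm (x - a *\<^sub>R y) = sqrt (1 - a\<^sup>2)"
    unfolding norm_eq_sqrt_inner a_def
    by (simp add: inner_diff_left inner_diff_right sq power2_eq_square inner_commute)
  have nb: "norm (z - b *\<^sub>R y) = sqrt (1 - b\<^sup>2)"
    unfolding norm_eq_sqrt_inner b_def
    by (simp add: inner_diff_left inner_diff_right sq power2_eq_square inner_commute)
  have "(x - a *\<^sub>R y) \<bullet> (z - b *\<^sub>R y) = x \<bullet> z - a * b"
    unfolding a_def b_def
    by (simp add: inner_diff_left inner_diff_right sq inner_commute algebra_simps)
  then have ge: "x \<bullet> z \<ge> a * b - sqrt (1 - a\<^sup>2) * sqrt (1 - b\<^sup>2)"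
    using Cauchy_Schwarz_ineq2[of "x - a *\<^sub>R y" "z - b *\<^sub>R y"] na nb by auto
  also have "a * b - sqrt (1 - a\<^sup>2) * sqrt (1 - b\<^sup>2) = cos (arccos a + arccos b)"
    using ab by (simp add: cos_add sin_arccos_abs abs_le_iff)
  finally have c: "cos (arccos a + arccos b) \<le> x \<bullet> z" .
  show ?thesis
  proof (cases "arccos a + arccos b \<le> pi")
    case True
    have "arccos (x \<bullet> z) \<le> arccos (cos (arccos a + arccos b))"
      using c inner_unit_bounds[OF n(1,3)] by (intro arccos_le_arccos) auto
    also have "\<dots> = arccos a + arccos b"
      using True ab by (intro arccos_cos) (auto simp: arccos_lbound add_nonneg_nonneg)
    finally show ?thesis unfolding a_def b_def .
  next
    case False
    then show ?thesis
      using arccos_ubound[of "x \<bullet> z"] inner_unit_bounds[OF n(1,3)]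
      unfolding a_def b_def by linarith
  qed
qed

instantiation rsphere :: metric_space
begin

definition dist_rsphere :: "rsphere \<Rightarrow> rsphere \<Rightarrow> real" where
  "dist_rsphere z w = arccos (stereo z \<bullet> stereo w)"

definition uniformity_rsphere :: "(rsphere \<times> rsphere) filter" where
  "uniformity_rsphere = (INF e\<in>{0 <..}. principal {(x, y). dist x y < e})"

definition open_rsphere :: "rsphere set \<Rightarrow> bool" where
  "open_rsphere S = (\<forall>x\<in>S. \<forall>\<^sub>F (x', y) in uniformity. x' = x \<longrightarrow> y \<in> S)"

instance
proof
  fix x y z :: rsphere
  show "dist x y = 0 \<longleftrightarrow> x = y"
  proof
    assume "dist x y = 0"
    then have "cos (arccos (stereo x \<bullet> stereo y)) = 1" by (simp add: dist_rsphere_def)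
    then have "stereo x \<bullet> stereo y = 1"
      using inner_unit_bounds[OF norm_stereo norm_stereo, of x y] by simp
    then have "(stereo x - stereo y) \<bullet> (stereo x - stereo y) = 0"
      by (simp add: inner_diff_left inner_diff_right inner_stereo_self inner_commute)
    then show "x = y" using inj_stereo by simp
  qed (simp add: dist_rsphere_def inner_stereo_self)
  show "dist x y \<le> dist x z + dist y z"
    using angle_triangle[of "stereo x" "stereo z" "stereo y"]
    by (simp add: dist_rsphere_def inner_commute)
qed (simp_all add: uniformity_rsphere_def open_rsphere_def)

end

lemma dist_rsphere_le_pi: "dist z w \<le> pi" for z w :: rsphere
  unfolding dist_rsphere_def
  using inner_unit_bounds[OF norm_stereo norm_stereo, of z w] by (intro arccos_ubound) auto


section \<open>The space of non-constant polynomial maps\<close>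

typedef poly_map = "{p :: complex poly. 0 < degree p}"
  morphisms poly_of Abs_poly_map
  by (rule exI[of _ "[:0, 1:]"]) simp

fun apply_poly :: "poly_map \<Rightarrow> rsphere \<Rightarrow> rsphere" where
  "apply_poly f (Fin z) = Fin (poly (poly_of f) z)"
| "apply_poly f Infty = Infty"

lemma apply_poly_inject: "apply_poly f = apply_poly g \<longleftrightarrow> f = g"
proof
  assume "apply_poly f = apply_poly g"
  then have "poly (poly_of f) z = poly (poly_of g) z" for z
    by (metis apply_poly.simps(1) rsphere.inject)
  then have "poly_of f = poly_of g" by (simp only: poly_eq_poly_eq_iff[symmetric] fun_eq_iff) blast
  then show "f = g" by (simp add: poly_of_inject)
qed simp

instantiation poly_map :: metric_space
begin

definition dist_poly_map :: "poly_map \<Rightarrow> poly_map \<Rightarrow> real" where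
  "dist_poly_map f g = (SUP z. dist (apply_poly f z) (apply_poly g z))"

definition uniformity_poly_map :: "(poly_map \<times> poly_map) filter" where
  "uniformity_poly_map = (INF e\<in>{0 <..}. principal {(x, y). dist x y < e})"

definition open_poly_map :: "poly_map set \<Rightarrow> bool" where
  "open_poly_map S = (\<forall>x\<in>S. \<forall>\<^sub>F (x', y) in uniformity. x' = x \<longrightarrow> y \<in> S)"

instance
proof
  fix f g h :: poly_map
  have bdd: "bdd_above (range (\<lambda>z. dist (apply_poly f z) (apply_poly g z)))" for f g
    by (intro bdd_aboveI[where M = pi]) (auto intro: dist_rsphere_le_pi)
  have le: "dist (apply_poly f z) (apply_poly g z) \<le> dist f g" for f g z
    unfolding dist_poly_map_def by (intro cSUP_upper bdd) auto
  show "dist f g = 0 \<longleftrightarrow> f = g"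
  proof
    assume "dist f g = 0"
    then have "dist (apply_poly f z) (apply_poly g z) = 0" for z
      using le[of f z g] zero_le_dist[of "apply_poly f z" "apply_poly g z"] by linarith
    then have "apply_poly f = apply_poly g" by (intro ext) simp
    then show "f = g" by (simp add: apply_poly_inject)
  qed (simp add: dist_poly_map_def)
  show "dist f g \<le> dist f h + dist g h"
    unfolding dist_poly_map_def[of f g]
  proof (rule cSUP_least)
    fix z
    have "dist (apply_poly f z) (apply_poly g z)
        \<le> dist (apply_poly f z) (apply_poly h z) + dist (apply_poly g z) (apply_poly h z)"
      by (rule dist_triangle2)
    also have "\<dots> \<le> dist f h + dist g h" by (intro add_mono le)
    finally show "dist (apply_poly f z) (apply_poly g z) \<le> dist f h + dist g h" .
  qed simp
qed (simp_all add: uniformity_poly_map_def open_poly_map_def)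

end

definition Poly_plus :: "poly_map set" where
  "Poly_plus = {f. degree (poly_of f) \<ge> 2}"

text \<open>For a sequence \<open>\<gamma>\<^sub>1, \<gamma>\<^sub>2, \<dots>\<close> stored as \<open>g 0, g 1, \<dots>\<close>, the map
  \<open>compose_upto g n\<close> is \<open>\<gamma>\<^sub>n \<circ> \<dots> \<circ> \<gamma>\<^sub>1\<close>.\<close>

primrec compose_upto :: "(nat \<Rightarrow> poly_map) \<Rightarrow> nat \<Rightarrow> rsphere \<Rightarrow> rsphere" where
  "compose_upto g 0 = id"
| "compose_upto g (Suc n) = apply_poly (g n) \<circ> compose_upto g n"


section \<open>Random systems with complete connections\<close>

definition topological_support :: "'a topology \<Rightarrow> 'a measure \<Rightarrow> 'a set" where
  "topological_support T M =
    {x \<in> topspace T. \<forall>U. openin T U \<longrightarrow> x \<in> U \<longrightarrow> emeasure M U > 0}"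

text \<open>Only the underlying \<open>\<sigma>\<close>-algebras of the measures \<open>MW\<close> and \<open>MX\<close> matter.\<close>

definition rscc ::
  "'w measure \<Rightarrow> 'x measure \<Rightarrow> ('w \<Rightarrow> 'x \<Rightarrow> 'w) \<Rightarrow> ('w \<Rightarrow> 'x measure) \<Rightarrow> bool" where
  "rscc MW MX u P \<longleftrightarrow>
    (\<lambda>(w, x). u w x) \<in> MW \<Otimes>\<^sub>M MX \<rightarrow>\<^sub>M MW \<and> P \<in> MW \<rightarrow>\<^sub>M prob_algebra MX"

definition induced_kernel ::
  "'w measure \<Rightarrow> ('w \<Rightarrow> 'x \<Rightarrow> 'w) \<Rightarrow> ('w \<Rightarrow> 'x measure) \<Rightarrow> 'w \<Rightarrow> 'w measure" where
  "induced_kernel MW u P w = distr (P w) MW (u w)"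

definition transition_operator ::
  "'w measure \<Rightarrow> ('w \<Rightarrow> 'x \<Rightarrow> 'w) \<Rightarrow> ('w \<Rightarrow> 'x measure) \<Rightarrow> ('w \<Rightarrow> real) \<Rightarrow> 'w \<Rightarrow> real" where
  "transition_operator MW u P f w = (\<integral>w'. f w' \<partial>induced_kernel MW u P w)"

definition standing_assumptions ::
  "('w::metric_space \<Rightarrow> 'x::finite \<Rightarrow> 'w) \<Rightarrow> ('w \<Rightarrow> 'x measure) \<Rightarrow> bool" where
  "standing_assumptions u P \<longleftrightarrow>
    compact (UNIV :: 'w set) \<and>
    (\<forall>x. continuous_on UNIV (\<lambda>v. measure (P v) {x})) \<and>
    (\<forall>f. continuous_on UNIV f \<longrightarrow> continuous_on UNIV (transition_operator borel u P f))"

definition polynomial_rscc ::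
  "'w measure \<Rightarrow> 'x measure \<Rightarrow> ('w \<Rightarrow> 'x \<Rightarrow> 'w) \<Rightarrow> ('w \<Rightarrow> 'x measure) \<Rightarrow>
    ('x \<Rightarrow> poly_map measure) \<Rightarrow> bool" where
  "polynomial_rscc MW MX u P \<tau> \<longleftrightarrow>
    rscc MW MX u P \<and> (\<forall>x\<in>space MX. \<tau> x \<in> space (prob_algebra borel))"

definition Gamma_set :: "('x \<Rightarrow> poly_map measure) \<Rightarrow> 'x \<Rightarrow> poly_map set" where
  "Gamma_set \<tau> x = topological_support euclidean (\<tau> x)"


section \<open>Path measures\<close>

text \<open>A word \<open>x\<^sub>1 \<dots> x\<^sub>n\<close> is the list \<open>[x\<^sub>1, \<dots>, x\<^sub>n]\<close>, so that the state reached from \<open>w\<close> is \<open>foldl u w xs\<close>;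
  infinite sequences are indexed from \<open>0\<close>.\<close>

definition cyl :: "'x list \<Rightarrow> (nat \<Rightarrow> 'x) set" where
  "cyl xs = {\<omega>. \<forall>i<length xs. \<omega> i = xs ! i}"

definition word_prob ::
  "('w \<Rightarrow> 'x \<Rightarrow> 'w) \<Rightarrow> ('w \<Rightarrow> 'x measure) \<Rightarrow> 'w \<Rightarrow> 'x list \<Rightarrow> real" where
  "word_prob u P w xs = (\<Prod>i<length xs. measure (P (foldl u w (take i xs))) {xs ! i})"

definition path_measure ::
  "('w \<Rightarrow> 'x \<Rightarrow> 'w) \<Rightarrow> ('w \<Rightarrow> 'x measure) \<Rightarrow> 'w \<Rightarrow> (nat \<Rightarrow> 'x) measure" where
  "path_measure u P w = (THE M. prob_space M \<and>
    sets M = sets (\<Pi>\<^sub>M i\<in>UNIV. count_space UNIV) \<and>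
    (\<forall>xs. measure M (cyl xs) = word_prob u P w xs))"

definition admissible_words ::
  "('w \<Rightarrow> 'x \<Rightarrow> 'w) \<Rightarrow> ('w \<Rightarrow> 'x measure) \<Rightarrow> 'w \<Rightarrow> nat \<Rightarrow> 'x list set" where
  "admissible_words u P w n = {xs. length xs = n \<and> measure (path_measure u P w) (cyl xs) > 0}"

definition composition_set ::
  "('w \<Rightarrow> 'x \<Rightarrow> 'w) \<Rightarrow> ('w \<Rightarrow> 'x measure) \<Rightarrow> ('x \<Rightarrow> poly_map measure) \<Rightarrow> 'w \<Rightarrow>
    (rsphere \<Rightarrow> rsphere) set" where
  "composition_set u P \<tau> w = {compose_upto g n | g n xs.
    n \<ge> 1 \<and> xs \<in> admissible_words u P w n \<and> (\<forall>j<n. g j \<in> Gamma_set \<tau> (xs ! j))}"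

definition Xi ::
  "('w \<Rightarrow> 'x \<Rightarrow> 'w) \<Rightarrow> ('w \<Rightarrow> 'x measure) \<Rightarrow> ('x \<Rightarrow> poly_map measure) \<Rightarrow> 'w \<Rightarrow>
    (nat \<Rightarrow> poly_map \<times> 'x) set" where
  "Xi u P \<tau> w = {\<omega>.
    (\<lambda>n. snd (\<omega> n)) \<in> topological_support
      (product_topology (\<lambda>_. discrete_topology UNIV) UNIV) (path_measure u P w) \<and>
    (\<forall>n. fst (\<omega> n) \<in> Gamma_set \<tau> (snd (\<omega> n)))}"

definition tau_tilde ::
  "('w \<Rightarrow> 'x \<Rightarrow> 'w) \<Rightarrow> ('w \<Rightarrow> 'x measure) \<Rightarrow> ('x \<Rightarrow> poly_map measure) \<Rightarrow> 'w \<Rightarrow>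
    (nat \<Rightarrow> poly_map \<times> 'x) measure" where
  "tau_tilde u P \<tau> w = (THE M. prob_space M \<and>
    sets M = sets (restrict_space (\<Pi>\<^sub>M i\<in>UNIV. borel \<Otimes>\<^sub>M count_space UNIV) (Xi u P \<tau> w)) \<and>
    (\<forall>n. \<forall>xs\<in>admissible_words u P w n. \<forall>A.
      (\<forall>k<n. A k \<in> sets borel \<and> A k \<subseteq> Gamma_set \<tau> (xs ! k)) \<longrightarrow>
      measure M {\<omega> \<in> Xi u P \<tau> w. \<forall>k<n. snd (\<omega> k) = xs ! k \<and> fst (\<omega> k) \<in> A k} =
        measure (path_measure u P w) (cyl xs) * (\<Prod>k<n. measure (\<tau> (xs ! k)) (A k))))"

definition escaping_probability ::
  "('w \<Rightarrow> 'x \<Rightarrow> 'w) \<Rightarrow> ('w \<Rightarrow> 'x measure) \<Rightarrow> ('x \<Rightarrow> poly_map measure) \<Rightarrow> 'w \<Rightarrow>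
    rsphere \<Rightarrow> real" where
  "escaping_probability u P \<tau> w z = measure (tau_tilde u P \<tau> w)
    {\<omega> \<in> Xi u P \<tau> w. (\<lambda>n. compose_upto (\<lambda>k. fst (\<omega> k)) n z) \<longlonglongrightarrow> Infty}"

definition smallest_filled_Julia ::
  "('w \<Rightarrow> 'x \<Rightarrow> 'w) \<Rightarrow> ('w \<Rightarrow> 'x measure) \<Rightarrow> ('x \<Rightarrow> poly_map measure) \<Rightarrow> 'w \<Rightarrow>
    rsphere set" where
  "smallest_filled_Julia u P \<tau> w = {z. \<exists>B. bounded B \<and> (\<lambda>h. h z) ` composition_set u P \<tau> w \<subseteq> Fin ` B}"

end

(* If z lies in the smallest filled-in Julia set, no orbit of z along an admissible marked path leaves
   a fixed bounded set, so the escape event is empty. Conversely, compactness of the sets Gamma_x in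
   Poly_+ gives a common escape radius R beyond which all maps at least double the modulus. If z is not
   in the filled-in Julia set, some admissible composition maps z outside the disc of radius R. This
   persists when each factor is perturbed in a small neighbourhood, and since the factors lie in the
   supports of the tau_x, the corresponding cylinder has positive measure. The path measures are given
   only by a description, so their existence and uniqueness have to be shown; tau_x is carried by
   Gamma_x because Poly is second countable (polynomials with coefficients from a countable dense set
   are dense). *)
theory Submission
  imports Defs "HOL-Complex_Analysis.Conformal_Mappings"
begin

section \<open>The spherical metric\<close>

text \<open>Escape is a limit condition, whereas positive mass comes from open boxes. The two meet
  because, once the escape radius is available, a path of \<open>Xi\<close> escapes exactly when its
  orbit enters one fixed open ball about \<open>Infty\<close>; the same equivalence makes the event
  measurable. For the radius, closeness in the spherical sup metric speaks about values and gives no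
  direct hold on coefficients, so compactness is used only to get |f z| \<ge> 1 outside one disc;
  degree at least 2 then turns this lower bound into quadratic growth. The description of
  \<open>tau_tilde\<close> prescribes values only for admissible words and for sets inside the
  supports. This still determines the measure, because every path in \<open>Xi\<close> has
  admissible prefixes and marks in the supports.\<close>

text \<open>The distance t is the angle between the two unit vectors, so 1 - cos t = 2 sin^2 (t/2).
  Since t/2 \<le> 2, the bound y \<le> 3 sin y on [0, 2] gives t^2 \<le> 36 sin^2 (t/2), which is
  the factor 18.\<close>

lemma dist_rsphere_sq_le:
  fixes v w :: rsphere
  shows "(dist v w)\<^sup>2 \<le> 18 * (1 - stereo v \<bullet> stereo w)"
proof -
  define t where "t = dist v w"
  have c: "cos t = stereo v \<bullet> stereo w"
    unfolding t_def dist_rsphere_def using inner_unit_bounds[of "stereo v" "stereo w"] by simp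
  define y where "y = t / 2"
  have y: "0 \<le> y" "y \<le> 2"
    unfolding y_def t_def using dist_rsphere_le_pi[of v w] pi_less_4 by auto
  have "\<bar>sin y - (\<Sum>m<3. sin_coeff m * y ^ m)\<bar> \<le> inverse (fact 3) * \<bar>y\<bar> ^ 3"
    by (rule Maclaurin_sin_bound)
  then have "\<bar>sin y - y\<bar> \<le> y ^ 3 / 6"
    using y by (simp add: eval_nat_numeral sin_coeff_def divide_simps)
  moreover have "y ^ 3 \<le> 4 * y"
  proof -
    have "y * y \<le> 2 * 2" using y by (intro mult_mono) auto
    then have "y * (y * y) \<le> y * 4" using y by (intro mult_left_mono) auto
    then show ?thesis by (simp add: power3_eq_cube mult.assoc)
  qed
  \<comment> \<open>\<open>sin y \<ge> y - y\<^sup>3 / 6\<close> and \<open>y\<^sup>2 \<le> 4\<close>\<close>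
  ultimately have "y \<le> 3 * sin y" by linarith
  then have "y\<^sup>2 \<le> (3 * sin y)\<^sup>2" using y by (intro power_mono) auto
  also have "\<dots> = 9 * (1 - cos t) / 2"
    using cos_double_sin[of y] by (simp add: y_def power_mult_distrib)
  finally show ?thesis by (simp add: y_def t_def[symmetric] c power_divide)
qed

text \<open>A chord is no longer than its arc: the chord has length 2 sin (t/2). This makes
  \<open>stereo\<close> nonexpansive, hence continuous.\<close>

lemma dist_rsphere_ge_chord:
  fixes v w :: rsphere
  shows "norm (stereo v - stereo w) \<le> dist v w"
proof -
  define t where "t = dist v w"
  have c: "cos t = stereo v \<bullet> stereo w"
    unfolding t_def dist_rsphere_def using inner_unit_bounds[of "stereo v" "stereo w"] by simp
  have "(norm (stereo v - stereo w))\<^sup>2 = 2 - 2 * cos t"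
    by (simp add: power2_norm_eq_inner inner_diff_left inner_diff_right inner_stereo_self
        inner_commute c)
  also have "\<dots> = (2 * sin (t / 2))\<^sup>2"
    using cos_double_sin[of "t / 2"] by (simp add: power_mult_distrib)
  also have "\<dots> \<le> t\<^sup>2"
    using abs_sin_x_le_abs_x[of "t / 2"] by (intro power2_le_iff_abs_le[THEN iffD2]) (auto simp: t_def)
  finally show ?thesis unfolding t_def by (rule power2_le_imp_le) simp
qed

text \<open>1 minus the inner product is half the squared chord, that is 2 |a - b|^2 / ((1 + |a|^2)
  (1 + |b|^2)); multiplied by 18 it yields the square of the right-hand side.\<close>

lemma dist_Fin_Fin_le:
  "dist (Fin a) (Fin b) \<le> 6 * cmod (a - b) / (sqrt (1 + (cmod a)\<^sup>2) * sqrt (1 + (cmod b)\<^sup>2))"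
proof -
  define r s where "r = (cmod a)\<^sup>2" and "s = (cmod b)\<^sup>2"
  have rs: "r \<ge> 0" "s \<ge> 0" by (auto simp: r_def s_def)
  have ab: "(cmod (a - b))\<^sup>2 = r + s - 2 * (a \<bullet> b)"
    by (simp add: r_def s_def power2_norm_eq_inner inner_diff_left inner_diff_right inner_commute)
  have "stereo (Fin a) \<bullet> stereo (Fin b) = (4 * (a \<bullet> b) + (r - 1) * (s - 1)) / ((1 + r) * (1 + s))"
    using rs by (simp add: inner_prod_def r_def[symmetric] s_def[symmetric] add_divide_distrib add.commute)
  then have "18 * (1 - stereo (Fin a) \<bullet> stereo (Fin b)) =
      18 * (1 - (4 * (a \<bullet> b) + (r - 1) * (s - 1)) / ((1 + r) * (1 + s)))" by simp
  also have "\<dots> = 36 * (r + s - 2 * (a \<bullet> b)) / ((1 + r) * (1 + s))"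
    using rs by (simp add: divide_simps) (simp add: algebra_simps)
  also have "\<dots> = (6 * cmod (a - b) / (sqrt (1 + r) * sqrt (1 + s)))\<^sup>2"
    using rs by (simp add: power_divide power_mult_distrib ab)
  finally have "(dist (Fin a) (Fin b))\<^sup>2 \<le> (6 * cmod (a - b) / (sqrt (1 + r) * sqrt (1 + s)))\<^sup>2"
    using dist_rsphere_sq_le[of "Fin a" "Fin b"] by simp
  then show ?thesis
    unfolding r_def s_def by (rule power2_le_imp_le) simp
qed

text \<open>Only the weight at \<open>a\<close> is kept. When \<open>b\<close> is a perturbation of
  the value \<open>a\<close>, the error may then grow in proportion to |a| without any bound on
  \<open>b\<close>.\<close>

lemma dist_Fin_Fin_le_sqrt:
  "dist (Fin a) (Fin b) \<le> 6 * cmod (a - b) / sqrt (1 + (cmod a)\<^sup>2)"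
proof -
  have "1 \<le> sqrt (1 + (cmod b)\<^sup>2)" by simp
  then have "sqrt (1 + (cmod a)\<^sup>2) * 1 \<le> sqrt (1 + (cmod a)\<^sup>2) * sqrt (1 + (cmod b)\<^sup>2)"
    by (intro mult_left_mono) auto
  moreover have "0 < sqrt (1 + (cmod c)\<^sup>2)" for c by (simp add: add_pos_nonneg)
  ultimately have "6 * cmod (a - b) / (sqrt (1 + (cmod a)\<^sup>2) * sqrt (1 + (cmod b)\<^sup>2))
      \<le> 6 * cmod (a - b) / sqrt (1 + (cmod a)\<^sup>2)"
    by (intro divide_left_mono mult_pos_pos) auto
  then show ?thesis using dist_Fin_Fin_le[of a b] by linarith
qed

lemma dist_Fin_Fin_le_norm: "dist (Fin a) (Fin b) \<le> 6 * cmod (a - b)"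
proof -
  have "1 \<le> sqrt (1 + (cmod a)\<^sup>2)" by simp
  then have "6 * cmod (a - b) / sqrt (1 + (cmod a)\<^sup>2) \<le> 6 * cmod (a - b) / 1"
    by (intro divide_left_mono mult_pos_pos) (auto simp: add_pos_nonneg)
  then show ?thesis using dist_Fin_Fin_le_sqrt[of a b] by simp
qed

lemma dist_Infty_Fin: "dist Infty (Fin a) = arccos (((cmod a)\<^sup>2 - 1) / ((cmod a)\<^sup>2 + 1))"
  by (simp add: dist_rsphere_def inner_prod_def)

text \<open>The height (r - 1) / (r + 1) increases with r = |a|^2 and \<open>arccos\<close>
  decreases. Balls about \<open>Infty\<close> thereby become exteriors of discs.\<close>

lemma dist_Infty_less_iff: "dist Infty (Fin a) < dist Infty (Fin b) \<longleftrightarrow> cmod b < cmod a"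
proof -
  have *: "\<bar>((cmod c)\<^sup>2 - 1) / ((cmod c)\<^sup>2 + 1)\<bar> \<le> 1" for c
  proof -
    have "\<bar>(r - 1) / (r + 1)\<bar> \<le> 1" if "r \<ge> 0" for r :: real
      using that by (simp add: abs_le_iff divide_simps)
    then show ?thesis using zero_le_power2 .
  qed
  have "dist Infty (Fin a) < dist Infty (Fin b) \<longleftrightarrow>
      ((cmod b)\<^sup>2 - 1) / ((cmod b)\<^sup>2 + 1) < ((cmod a)\<^sup>2 - 1) / ((cmod a)\<^sup>2 + 1)"
    unfolding dist_Infty_Fin by (intro arccos_less_mono *)
  also have "\<dots> \<longleftrightarrow> (cmod b)\<^sup>2 < (cmod a)\<^sup>2"
  proof -
    have "(s - 1) / (s + 1) < (r - 1) / (r + 1) \<longleftrightarrow> s < r" if "r \<ge> 0" "s \<ge> 0" for r s :: real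
      using that by (simp add: divide_simps) (simp add: algebra_simps)
    then show ?thesis by simp
  qed
  also have "\<dots> \<longleftrightarrow> cmod b < cmod a"
    by (metis norm_ge_zero power_strict_mono power2_less_imp_less zero_less_numeral)
  finally show ?thesis .
qed

lemma dist_Infty_Fin_le: "dist Infty (Fin a) \<le> 6 / sqrt (1 + (cmod a)\<^sup>2)"
proof -
  define r where "r = (cmod a)\<^sup>2"
  have r: "r \<ge> 0" by (simp add: r_def)
  have "18 * (1 - stereo Infty \<bullet> stereo (Fin a)) = (6 / sqrt (1 + r))\<^sup>2"
    using r by (simp add: inner_prod_def r_def[symmetric] power_divide) (simp add: divide_simps)
  then have "(dist Infty (Fin a))\<^sup>2 \<le> (6 / sqrt (1 + r))\<^sup>2"
    using dist_rsphere_sq_le[of Infty "Fin a"] by simp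
  then show ?thesis unfolding r_def by (rule power2_le_imp_le) simp
qed

lemma dist_Infty_Fin_lt:
  assumes "e > 0" "cmod a \<ge> 6 / e"
  shows "dist Infty (Fin a) < e"
proof -
  have "6 / e < sqrt (1 + (cmod a)\<^sup>2)"
    using assms(2) real_sqrt_less_mono[of "(cmod a)\<^sup>2" "1 + (cmod a)\<^sup>2"] by simp
  moreover have "0 < sqrt (1 + (cmod a)\<^sup>2)" by (simp add: add_pos_nonneg)
  ultimately have "6 / sqrt (1 + (cmod a)\<^sup>2) < e" using assms(1) by (simp add: field_simps)
  then show ?thesis using dist_Infty_Fin_le[of a] by linarith
qed

section \<open>Continuity of polynomial maps on the sphere\<close>

lemma continuous_Fin: "continuous_on UNIV Fin"
  unfolding continuous_on_iff
proof (intro ballI allI impI)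
  fix x :: complex and e :: real assume "e > 0"
  then show "\<exists>d>0. \<forall>x'\<in>UNIV. dist x' x < d \<longrightarrow> dist (Fin x') (Fin x) < e"
    using dist_Fin_Fin_le_norm by (intro exI[of _ "e / 6"]) (fastforce simp: dist_norm intro: le_less_trans)
qed

lemma isCont_apply_poly_Fin: "isCont (apply_poly f) (Fin a)"
proof -
  \<comment> \<open>Stereographic projection back to the plane, in ambient coordinates. It inverts
    \<open>Fin\<close>; at \<open>Infty\<close> division by zero makes it 0, so the formula for
    \<open>apply_poly\<close> through \<open>q\<close> is used only on a neighbourhood of
    \<open>Fin a\<close> that misses \<open>Infty\<close>.\<close>
  define q where "q v = (1 / (1 - snd (stereo v))) *\<^sub>R fst (stereo v)" for v
  have q: "q (Fin b) = b" for b
  proof -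
    define s where "s = (cmod b)\<^sup>2"
    have s: "s \<ge> 0" by (simp add: s_def)
    then have "1 - (s - 1) / (s + 1) = 2 / (1 + s)" by (simp add: field_simps)
    then have "q (Fin b) = (1 / (2 / (1 + s)) * (2 / (1 + s))) *\<^sub>R b"
      unfolding q_def by (simp only: stereo.simps fst_conv snd_conv s_def[symmetric] scaleR_scaleR)
    moreover have "1 / t * t = 1" if "t \<noteq> 0" for t :: real using that by simp
    ultimately show ?thesis using s by (metis divide_eq_0_iff add_nonneg_eq_0_iff scaleR_one zero_le_one zero_neq_numeral zero_neq_one)
  qed
  have ne: "1 - snd (stereo (Fin a)) \<noteq> 0"
    using zero_le_power2[of "cmod a"] by (simp add: divide_simps)
  have "isCont stereo (Fin a)"
    unfolding continuous_at_eps_delta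
  proof (intro allI impI)
    fix e :: real assume "e > 0"
    then show "\<exists>d>0. \<forall>v. dist v (Fin a) < d \<longrightarrow> dist (stereo v) (stereo (Fin a)) < e"
      unfolding dist_norm using dist_rsphere_ge_chord by (intro exI[of _ e]) (auto intro: le_less_trans simp del: stereo.simps)
  qed
  then have "isCont q (Fin a)"
    unfolding q_def using ne by (intro continuous_intros) auto
  then have "isCont (\<lambda>v. poly (poly_of f) (q v)) (Fin a)"
    by (rule isCont_o2) (rule poly_isCont)
  then have "isCont (\<lambda>v. Fin (poly (poly_of f) (q v))) (Fin a)"
    by (rule isCont_o2) (use continuous_Fin in \<open>simp add: continuous_on_eq_continuous_at\<close>)
  moreover have "eventually (\<lambda>v. apply_poly f v = Fin (poly (poly_of f) (q v))) (nhds (Fin a))"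
  proof -
    have "eventually (\<lambda>v. v \<noteq> Infty) (nhds (Fin a))"
      using t1_space_nhds[of "Fin a" Infty] by simp
    then show ?thesis
    proof eventually_elim
      case (elim v)
      then show ?case by (cases v) (simp_all add: q)
    qed
  qed
  ultimately show ?thesis by (subst isCont_cong) auto
qed

lemma isCont_apply_poly_Infty: "isCont (apply_poly f) Infty"
  unfolding continuous_at_eps_delta
proof (intro allI impI)
  fix e :: real assume e: "e > 0"
  have "filterlim (poly (poly_of f)) at_infinity at_infinity"
    using poly_of[of f] by (intro filterlim_poly_at_infinity) auto
  then have "eventually (\<lambda>z. 6 / e \<le> cmod (poly (poly_of f) z)) at_infinity"
    using e by (auto simp: filterlim_at_infinity[of 0])
  then obtain b where b: "\<And>z. b \<le> cmod z \<Longrightarrow> 6 / e \<le> cmod (poly (poly_of f) z)"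
    unfolding eventually_at_infinity by blast
  \<comment> \<open>The ball of this radius about \<open>Infty\<close> is the exterior of the disc
    of radius |b|; the absolute value guards against a negative \<open>b\<close>.\<close>
  define d where "d = dist Infty (Fin (of_real \<bar>b\<bar>))"
  have "dist (apply_poly f v) (apply_poly f Infty) < e" if "dist v Infty < d" for v
  proof (cases v)
    case (Fin a)
    then have "b \<le> cmod a"
      using that dist_Infty_less_iff[of a "of_real \<bar>b\<bar>"] by (simp add: d_def dist_commute)
    then show ?thesis using Fin e b dist_Infty_Fin_lt by (simp add: dist_commute)
  qed (simp add: e)
  then show "\<exists>d>0. \<forall>v. dist v Infty < d \<longrightarrow> dist (apply_poly f v) (apply_poly f Infty) < e"
    by (intro exI[of _ d]) (simp add: d_def)
qed

lemma dist_apply_poly_le: "dist (apply_poly f v) (apply_poly g v) \<le> dist f g"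
  unfolding dist_poly_map_def
  by (intro cSUP_upper bdd_aboveI[where M = pi]) (auto intro: dist_rsphere_le_pi)

text \<open>The sup metric bounds the distance from g w to f w uniformly in w, which leaves the
  continuity of the single map f at v. Joint continuity serves both the open boxes of maps and the
  measurability of orbits.\<close>

lemma continuous_on_apply_poly: "continuous_on UNIV (\<lambda>(f, v). apply_poly f v)"
  unfolding continuous_on_eq_continuous_at[OF open_UNIV] continuous_at_eps_delta
proof (intro ballI allI impI, clarsimp)
  fix f v and e :: real assume e: "e > 0"
  have "isCont (apply_poly f) v"
    using isCont_apply_poly_Fin isCont_apply_poly_Infty by (cases v) auto
  then obtain d where d: "d > 0" "\<And>w. dist w v < d \<Longrightarrow> dist (apply_poly f w) (apply_poly f v) < e / 2"
    using e unfolding continuous_at_eps_delta by (auto dest: spec[of _ "e / 2"])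
  show "\<exists>d>0. \<forall>g w. dist (g, w) (f, v) < d \<longrightarrow> dist (apply_poly g w) (apply_poly f v) < e"
  proof (intro exI[of _ "min d (e / 2)"] conjI allI impI)
    fix g w assume l: "dist (g, w) (f, v) < min d (e / 2)"
    have "dist g f < e / 2" "dist w v < d"
      using l dist_fst_le[of "(g, w)" "(f, v)"] dist_snd_le[of "(g, w)" "(f, v)"] by auto
    then show "dist (apply_poly g w) (apply_poly f v) < e"
      using d(2)[of w] dist_apply_poly_le[of g w f]
        dist_triangle[of "apply_poly g w" "apply_poly f v" "apply_poly f w"] by linarith
  qed (use d e in auto)
qed

section \<open>Second countability and the escape radius\<close>

lemma countable_dense_imp_countable_basis:
  fixes D :: "'a::metric_space set"
  assumes "countable D" and dense: "\<And>x e. e > 0 \<Longrightarrow> \<exists>y\<in>D. dist x y < e"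
  shows "\<exists>B::'a set set. countable B \<and> open = generate_topology B"
proof -
  define B where "B = (\<lambda>(y, n). ball y (1 / real (Suc n))) ` (D \<times> (UNIV :: nat set))"
  have "topological_basis B"
  proof (rule topological_basisI)
    fix O' :: "'a set" and x assume O': "open O'" "x \<in> O'"
    then obtain e where e: "e > 0" "ball x e \<subseteq> O'" by (rule openE)
    obtain n where n: "1 / real (Suc n) < e / 2"
      using e(1) nat_approx_posE half_gt_zero by blast
    obtain y where y: "y \<in> D" "dist x y < 1 / real (Suc n)"
      using dense[of "1 / real (Suc n)" x] by auto
    have "ball y (1 / real (Suc n)) \<subseteq> O'"
    proof
      fix v assume "v \<in> ball y (1 / real (Suc n))"
      then have "dist x v < e"
        using y n dist_triangle[of x v y] by simp
      then show "v \<in> O'" using e by auto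
    qed
    moreover have "x \<in> ball y (1 / real (Suc n))" using y by (simp add: dist_commute)
    ultimately show "\<exists>B'\<in>B. x \<in> B' \<and> B' \<subseteq> O'"
      using y(1) by (auto simp: B_def)
  qed (auto simp: B_def)
  moreover have "countable B" using assms(1) by (auto simp: B_def)
  ultimately show ?thesis using topological_basis_imp_subbasis by blast
qed

text \<open>Together with the instance for \<open>poly_map\<close> this makes a pair of Borel maps
  into \<open>poly_map\<close> and \<open>rsphere\<close> Borel measurable, as the measurability of
  compositions requires.\<close>

instance rsphere :: second_countable_topology
proof
  obtain D :: "complex set" where D: "countable D" "\<And>U. open U \<Longrightarrow> U \<noteq> {} \<Longrightarrow> \<exists>d\<in>D. d \<in> U"
    using countable_dense_exists by metis
  show "\<exists>B::rsphere set set. countable B \<and> open = generate_topology B"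
  proof (rule countable_dense_imp_countable_basis[of "insert Infty (Fin ` D)"])
    fix v :: rsphere and e :: real assume e: "e > 0"
    show "\<exists>y\<in>insert Infty (Fin ` D). dist v y < e"
    proof (cases v)
      case (Fin a)
      obtain d where "d \<in> D" "d \<in> ball a (e / 6)"
        using D(2)[of "ball a (e / 6)"] e by auto
      then show ?thesis
        using Fin dist_Fin_Fin_le_norm[of a d] by (intro bexI[of _ "Fin d"]) (auto simp: dist_norm)
    qed (use e in auto)
  qed (use D in auto)
qed

section \<open>Approximation of polynomial maps in the spherical sup metric\<close>

text \<open>Near infinity |p z| is at least half of |lead coefficient| |z|^d; on the remaining disc,
  where \<open>p\<close> may vanish, the 1 under the root gives the bound.\<close>

lemma power_degree_le_norm_poly:
  fixes p :: "complex poly"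
  assumes "p \<noteq> 0"
  obtains C where "C > 0" "\<And>z. max 1 (cmod z) ^ degree p \<le> C * sqrt (1 + (cmod (poly p z))\<^sup>2)"
proof -
  define d l where "d = degree p" and "l = cmod (lead_coeff p)"
  have l: "l > 0" using assms by (simp add: l_def)
  have "((\<lambda>z. cmod (poly p z / z ^ d)) \<longlongrightarrow> l) at_infinity"
    unfolding d_def l_def by (intro tendsto_norm poly_divide_tendsto_aux)
  then have "eventually (\<lambda>z. l / 2 < cmod (poly p z / z ^ d)) at_infinity"
    by (rule order_tendstoD) (use l in auto)
  then obtain b where b: "\<And>z. b \<le> cmod z \<Longrightarrow> l / 2 < cmod (poly p z / z ^ d)"
    unfolding eventually_at_infinity by blast
  define C where "C = max b 1 ^ d + 2 / l"
  have C: "C > 0" using l by (simp add: C_def add_pos_pos)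
  show thesis
  proof (rule that[OF C])
    fix z
    have s: "1 \<le> sqrt (1 + (cmod (poly p z))\<^sup>2)" "cmod (poly p z) \<le> sqrt (1 + (cmod (poly p z))\<^sup>2)"
      by (auto intro: real_le_rsqrt)
    have "max 1 (cmod z) ^ d \<le> C * sqrt (1 + (cmod (poly p z))\<^sup>2)"
    proof (cases "cmod z \<le> max b 1")
      case True
      then have "max 1 (cmod z) ^ d \<le> max b 1 ^ d * 1" using power_mono[of "max 1 (cmod z)" "max b 1" d] by simp
      also have "\<dots> \<le> C * sqrt (1 + (cmod (poly p z))\<^sup>2)"
        using s C l by (intro mult_mono) (auto simp: C_def)
      finally show ?thesis .
    next
      case False
      then have "max 1 (cmod z) = cmod z" "z \<noteq> 0" by auto
      moreover have "l / 2 < cmod (poly p z) / cmod z ^ d"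
        using b[of z] False by (simp add: norm_divide norm_power)
      ultimately have "max 1 (cmod z) ^ d \<le> 2 / l * cmod (poly p z)"
        using l by (simp add: field_simps)
      also have "\<dots> \<le> C * sqrt (1 + (cmod (poly p z))\<^sup>2)"
        using s C l by (intro mult_mono) (auto simp: C_def)
      finally show ?thesis .
    qed
    then show "max 1 (cmod z) ^ degree p \<le> C * sqrt (1 + (cmod (poly p z))\<^sup>2)"
      by (simp add: d_def)
  qed
qed

text \<open>Changing each coefficient by less than \<eta> moves p z by at most (d + 1) \<eta> max(1,
  |z|)^d. The spherical weight at p z cancels exactly this growth, so the error is uniform over the
  sphere, including near infinity.\<close>

lemma poly_map_approx:
  assumes D: "\<And>U :: complex set. open U \<Longrightarrow> U \<noteq> {} \<Longrightarrow> \<exists>d\<in>D. d \<in> U" and e: "e > 0"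
  shows "\<exists>g. poly_of g \<in> Poly ` lists D \<and> dist f g < e"
proof -
  define p d where "p = poly_of f" and "d = degree p"
  have d: "d > 0" using poly_of[of f] by (simp add: d_def p_def)
  then have p: "p \<noteq> 0" by (auto simp: d_def)
  obtain C where C: "C > 0" "\<And>z. max 1 (cmod z) ^ d \<le> C * sqrt (1 + (cmod (poly p z))\<^sup>2)"
    using power_degree_le_norm_poly[OF p] unfolding d_def by blast
  \<comment> \<open>The first entry keeps the leading coefficient nonzero, so the degree stays
    \<open>d\<close>; the second makes the spherical error at most 6 * (e / 12) = e / 2, which
    leaves room for the supremum.\<close>
  define \<eta> where "\<eta> = min (cmod (coeff p d)) (e / (12 * real (d + 1) * C))"
  have \<eta>: "\<eta> > 0" using p C e by (simp add: \<eta>_def d_def)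
  have "\<forall>i. \<exists>x. x \<in> D \<and> dist (coeff p i) x < \<eta>"
    using D[of "ball (coeff p i) \<eta>" for i] \<eta> by (metis mem_ball open_ball ball_eq_empty not_le)
  then obtain c where c: "\<And>i. c i \<in> D" "\<And>i. dist (coeff p i) (c i) < \<eta>" by metis
  define q where "q = Poly (map c [0..<Suc d])"
  have cq: "coeff q i = (if i \<le> d then c i else 0)" for i
    by (simp add: q_def nth_default_def less_Suc_eq_le del: upt_Suc)
  have "c d \<noteq> 0" using c(2)[of d] by (auto simp: \<eta>_def dist_norm)
  then have dq: "degree q = d"
    by (intro antisym degree_le le_degree) (auto simp: cq)
  define g where "g = Abs_poly_map q"
  have g: "poly_of g = q" unfolding g_def using dq d by (simp add: Abs_poly_map_inverse)
  have "dist (apply_poly f v) (apply_poly g v) \<le> e / 2" for v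
  proof (cases v)
    case (Fin z)
    define s where "s = sqrt (1 + (cmod (poly p z))\<^sup>2)"
    have s: "s > 0" by (simp add: s_def add_pos_nonneg)
    have "poly p z - poly q z = (\<Sum>i\<le>d. (coeff p i - c i) * z ^ i)"
      by (simp add: poly_altdef dq d_def[symmetric] sum_subtractf[symmetric] cq left_diff_distrib)
    also have "cmod \<dots> \<le> (\<Sum>i\<le>d. \<eta> * max 1 (cmod z) ^ d)"
    proof (rule sum_norm_le)
      fix i assume i: "i \<in> {..d}"
      have "cmod z ^ i \<le> max 1 (cmod z) ^ i" by (intro power_mono) auto
      also have "\<dots> \<le> max 1 (cmod z) ^ d" using i by (intro power_increasing) auto
      finally show "cmod ((coeff p i - c i) * z ^ i) \<le> \<eta> * max 1 (cmod z) ^ d"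
        unfolding norm_mult norm_power
        using c(2)[of i] \<eta> by (intro mult_mono) (auto simp: dist_norm)
    qed
    also have "\<dots> = real (d + 1) * \<eta> * max 1 (cmod z) ^ d" by simp
    also have "\<dots> \<le> real (d + 1) * \<eta> * (C * s)"
      unfolding s_def using C(2)[of z] \<eta> by (intro mult_left_mono) auto
    finally have "cmod (poly p z - poly q z) / s \<le> real (d + 1) * \<eta> * C"
      using s by (simp add: field_simps)
    moreover have "real (d + 1) * \<eta> * C \<le> e / 12"
    proof -
      have "\<eta> \<le> e / (12 * real (d + 1) * C)" by (simp add: \<eta>_def)
      moreover have "0 < 12 * real (d + 1) * C" using C(1) by simp
      ultimately have "\<eta> * (12 * real (d + 1) * C) \<le> e" by (simp only: pos_le_divide_eq)
      then show ?thesis by (simp add: algebra_simps)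
    qed
    moreover have "dist (apply_poly f v) (apply_poly g v) \<le> 6 * (cmod (poly p z - poly q z) / s)"
      using dist_Fin_Fin_le_sqrt[of "poly p z" "poly q z"] by (simp add: Fin g p_def s_def)
    ultimately show ?thesis by linarith
  qed (use e in auto)
  then have "dist f g \<le> e / 2" unfolding dist_poly_map_def by (intro cSUP_least) auto
  moreover have "poly_of g \<in> Poly ` lists D"
    unfolding g q_def using c(1) by (intro imageI) auto
  ultimately show ?thesis using e by (intro exI[of _ g]) auto
qed

instance poly_map :: second_countable_topology
proof
  obtain D :: "complex set" where D: "countable D" "\<And>U. open U \<Longrightarrow> U \<noteq> {} \<Longrightarrow> \<exists>d\<in>D. d \<in> U"
    using countable_dense_exists by metis
  show "\<exists>B::poly_map set set. countable B \<and> open = generate_topology B"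
  proof (rule countable_dense_imp_countable_basis[of "poly_of -` (Poly ` lists D)"])
    show "countable (poly_of -` (Poly ` lists D))"
    proof (rule countable_image_inj_on)
      show "countable (poly_of ` poly_of -` (Poly ` lists D))"
        using D(1) by (intro countable_subset[OF image_vimage_subset] countable_image countable_lists)
    qed (simp add: inj_on_def poly_of_inject)
    show "\<exists>y\<in>poly_of -` (Poly ` lists D). dist f y < e" if "e > 0" for f and e :: real
      using poly_map_approx[OF D(2) that] by (metis vimage_eq)
  qed
qed

text \<open>The maximum principle for \<open>z\<^sup>2 / p z\<close> near infinity, in the coordinate \<open>u = 1 / z\<close>. Only a lower
  bound for the modulus of \<open>p\<close> enters, so the estimate is uniform over nearby polynomials of any degree.\<close>

lemma norm_poly_ge_exterior:
  fixes p :: "complex poly"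
  assumes deg: "degree p \<ge> 2" and R: "R > 0"
    and ge: "\<And>z. R \<le> cmod z \<Longrightarrow> 1 \<le> cmod (poly p z)" and z: "R \<le> cmod z"
  shows "(cmod z / R)\<^sup>2 \<le> cmod (poly p z)"
proof -
  define d q where "d = degree p" and "q = reflect_poly p"
  \<comment> \<open>For u = 1 / z this is z^2 / p z. The reflected polynomial removes the
    singularity at u = 0, where its value is the leading coefficient of \<open>p\<close>; the
    exponent d - 2 is where degree at least 2 enters.\<close>
  define h where "h u = u ^ (d - 2) / poly q u" for u
  have q: "poly q u = u ^ d * poly p (inverse u)" if "u \<noteq> 0" for u
    unfolding q_def d_def using that by (rule poly_reflect_poly_nz)
  have inv: "R \<le> cmod (inverse u)" if "u \<noteq> 0" "cmod u \<le> 1 / R" for u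
    using that R by (simp add: norm_inverse norm_divide field_simps)
  have nz: "poly q u \<noteq> 0" if "cmod u \<le> 1 / R" for u
  proof (cases "u = 0")
    case True
    then show ?thesis using deg by (auto simp: q_def)
  next
    case False
    then show ?thesis using q[OF False] ge[OF inv[OF False that]] by auto
  qed
  have h: "cmod (h u) = 1 / ((cmod u)\<^sup>2 * cmod (poly p (inverse u)))" if "u \<noteq> 0" for u
  proof -
    have "u ^ d = u ^ (d - 2) * u ^ 2" using deg by (simp only: d_def le_add_diff_inverse2 flip: power_add)
    then show ?thesis using that by (simp add: h_def q norm_divide norm_mult norm_power)
  qed
  have hol: "h holomorphic_on cball 0 (1 / R)"
    unfolding h_def using nz by (intro holomorphic_intros) auto
  have "cmod (h (inverse z)) \<le> R\<^sup>2"
  proof (rule maximum_modulus_frontier[of h "cball 0 (1 / R)"])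
    show "h holomorphic_on interior (cball 0 (1 / R))"
      using hol interior_subset by (rule holomorphic_on_subset)
    show "continuous_on (closure (cball 0 (1 / R))) h"
      using hol by (simp add: holomorphic_on_imp_continuous_on)
    show "inverse z \<in> cball 0 (1 / R)" using z R by (simp add: norm_inverse divide_inverse le_imp_inverse_le)
    show "cmod (h u) \<le> R\<^sup>2" if "u \<in> frontier (cball 0 (1 / R))" for u
    proof -
      have u: "cmod u = 1 / R" using that R by simp
      then have "u \<noteq> 0" using R by auto
      then have "1 \<le> cmod (poly p (inverse u))" using ge inv u by simp
      then have "R\<^sup>2 / cmod (poly p (inverse u)) \<le> R\<^sup>2 / 1"
        by (intro divide_left_mono mult_pos_pos) auto
      then show ?thesis by (simp add: h[OF \<open>u \<noteq> 0\<close>] u power_divide)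
    qed
  qed simp
  moreover have "z \<noteq> 0" using z R by auto
  moreover have "0 < cmod (poly p z)" using ge[OF z] by linarith
  ultimately have "(cmod z)\<^sup>2 / cmod (poly p z) \<le> R\<^sup>2"
    by (simp add: h norm_inverse norm_divide power_divide field_simps)
  then show ?thesis using R \<open>0 < cmod (poly p z)\<close> by (simp add: power_divide field_simps)
qed

text \<open>Finitely many balls of radius pi/4 cover \<open>K\<close>, and each centre sends the
  exterior of some disc to within pi/4 of \<open>Infty\<close>. By the triangle inequality every map
  of \<open>K\<close> sends the exterior of a common disc into the open hemisphere of radius pi/2,
  which gives the lower bound 1 that the quadratic estimate asks for.\<close>

lemma escape_radius:
  assumes "compact K" "K \<subseteq> Poly_plus"
  obtains R where "R \<ge> 1"
    "\<And>f z. f \<in> K \<Longrightarrow> R \<le> cmod z \<Longrightarrow> 2 * cmod z \<le> cmod (poly (poly_of f) z)"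
proof -
  obtain F where F: "finite F" "K \<subseteq> (\<Union>f\<in>F. ball f (pi / 4))"
    using compact_eq_totally_bounded[of K] assms(1) pi_gt_zero by (metis divide_pos_pos zero_less_numeral)
  \<comment> \<open>The open hemisphere around \<open>Infty\<close> is the outside of the closed unit disc.\<close>
  have one: "dist Infty (Fin 1) = pi / 2" by (simp add: dist_Infty_Fin)
  have "\<exists>b. \<forall>z. b \<le> cmod z \<longrightarrow> dist Infty (Fin (poly (poly_of f) z)) < pi / 4" for f
  proof -
    have "filterlim (poly (poly_of f)) at_infinity at_infinity"
      using poly_of[of f] by (intro filterlim_poly_at_infinity) auto
    then have "eventually (\<lambda>z. 6 / (pi / 4) \<le> cmod (poly (poly_of f) z)) at_infinity"
      using pi_gt_zero by (auto simp: filterlim_at_infinity[of 0])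
    then show ?thesis
      unfolding eventually_at_infinity using dist_Infty_Fin_lt[of "pi / 4"] by fastforce
  qed
  then obtain b where b: "\<And>f z. b f \<le> cmod z \<Longrightarrow> dist Infty (Fin (poly (poly_of f) z)) < pi / 4"
    by metis
  define S where "S = Max (insert 1 (b ` F))"
  have S: "S \<ge> 1" "\<And>f. f \<in> F \<Longrightarrow> b f \<le> S" using F(1) by (auto simp: S_def)
  have ge1: "1 \<le> cmod (poly (poly_of f) z)" if f: "f \<in> K" and z: "S \<le> cmod z" for f z
  proof -
    obtain g where g: "g \<in> F" "dist g f < pi / 4" using subsetD[OF F(2) f] by auto
    have "dist Infty (Fin (poly (poly_of f) z))
        \<le> dist Infty (Fin (poly (poly_of g) z)) + dist g f"
      using dist_apply_poly_le[of g "Fin z" f] dist_triangle[of Infty "Fin (poly (poly_of f) z)" "Fin (poly (poly_of g) z)"]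
      by simp
    also have "\<dots> < dist Infty (Fin 1)" using g S(2) z b[of g z] one by fastforce
    finally show ?thesis by (simp add: dist_Infty_less_iff)
  qed
  show thesis
  \<comment> \<open>From |z| = 2 S^2 on, the quadratic bound (|z| / S)^2 dominates 2 |z|.\<close>
  proof (rule that[of "2 * S\<^sup>2"])
    have "1 \<le> S\<^sup>2" using S(1) by simp
    then show "1 \<le> 2 * S\<^sup>2" by linarith
    fix f z assume f: "f \<in> K" and z: "2 * S\<^sup>2 \<le> cmod z"
    have "S \<le> 2 * S\<^sup>2" using S(1) self_le_power[of S 2] by simp
    then have "S \<le> cmod z" using z by linarith
    then have "(cmod z / S)\<^sup>2 \<le> cmod (poly (poly_of f) z)"
      using f assms(2) ge1 S(1) by (intro norm_poly_ge_exterior) (auto simp: Poly_plus_def)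
    moreover have "2 * cmod z \<le> (cmod z / S)\<^sup>2"
    proof -
      have "2 * S\<^sup>2 * cmod z \<le> cmod z * cmod z" using z by (intro mult_right_mono) auto
      then show ?thesis using S(1) by (simp add: field_simps power2_eq_square)
    qed
    ultimately show "2 * cmod z \<le> cmod (poly (poly_of f) z)" by linarith
  qed
qed

section \<open>Measures on sequences and supports\<close>

text \<open>A finite-dimensional box splits into finitely many disjoint pieces according to the
  letters read at the first \<open>n\<close> times, because the alphabet is finite. The letter map
  \<open>c\<close> is the identity for paths and \<open>snd\<close> for marked paths.\<close>

lemma measure_eqI_words:
  fixes M N :: "(nat \<Rightarrow> 'b) measure" and c :: "'b \<Rightarrow> 'x::finite"
  assumes M: "prob_space M" "sets M = sets (Pi\<^sub>M UNIV (\<lambda>_. K))"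
    and N: "sets N = sets (Pi\<^sub>M UNIV (\<lambda>_. K))"
    and c [measurable]: "c \<in> measurable K (count_space UNIV)"
    and eq: "\<And>xs A. (\<And>k. A k \<in> sets K) \<Longrightarrow>
      emeasure M {\<omega> \<in> space (Pi\<^sub>M UNIV (\<lambda>_. K)). \<forall>k<length xs. c (\<omega> k) = xs ! k \<and> \<omega> k \<in> A k} =
      emeasure N {\<omega> \<in> space (Pi\<^sub>M UNIV (\<lambda>_. K)). \<forall>k<length xs. c (\<omega> k) = xs ! k \<and> \<omega> k \<in> A k}"
  shows "M = N"
proof (rule measure_eqI_PiM_infinite[OF M(2) N])
  show "finite_measure M" using M(1) by (rule prob_space.axioms(1))
  fix A :: "nat \<Rightarrow> 'b set" and J :: "nat set"
  assume J: "finite J" and A: "\<And>i. i \<in> J \<Longrightarrow> A i \<in> sets K"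
  obtain n where n: "J \<subseteq> {..<n}" using finite_nat_iff_bounded J by blast
  define A' where "A' k = (if k \<in> J then A k else space K)" for k
  have A' [measurable]: "A' k \<in> sets K" for k using A by (simp add: A'_def)
  define W where "W = {xs :: 'x list. length xs = n}"
  define E where "E xs = {\<omega> \<in> space (Pi\<^sub>M UNIV (\<lambda>_. K)). \<forall>k<length xs. c (\<omega> k) = xs ! k \<and> \<omega> k \<in> A' k}" for xs
  have W: "finite W" unfolding W_def using finite_lists_length_eq[of "UNIV :: 'x set" n] by simp
  have E: "E xs \<in> sets (Pi\<^sub>M UNIV (\<lambda>_. K))" for xs unfolding E_def by measurable
  have disj: "disjoint_family_on E W"
  proof (unfold disjoint_family_on_def, intro ballI impI, rule equals0I)
    fix xs ys \<omega> assume "xs \<in> W" "ys \<in> W" "xs \<noteq> ys" "\<omega> \<in> E xs \<inter> E ys"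
    then show False by (auto simp: E_def W_def list_eq_iff_nth_eq)
  qed
  have "prod_emb UNIV (\<lambda>_. K) J (Pi\<^sub>E J A) = (\<Union>xs\<in>W. E xs)"
  proof (intro equalityI subsetI)
    fix \<omega> assume "\<omega> \<in> prod_emb UNIV (\<lambda>_. K) J (Pi\<^sub>E J A)"
    then have "\<omega> \<in> E (map (\<lambda>k. c (\<omega> k)) [0..<n])"
      by (auto simp: prod_emb_iff E_def A'_def space_PiM PiE_iff)
    then show "\<omega> \<in> (\<Union>xs\<in>W. E xs)" by (rule UN_I[rotated]) (simp add: W_def)
  next
    fix \<omega> assume "\<omega> \<in> (\<Union>xs\<in>W. E xs)"
    then obtain xs where xs: "xs \<in> W" "\<omega> \<in> E xs" by blast
    have "\<omega> k \<in> A k" if "k \<in> J" for k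
    proof -
      have "\<omega> k \<in> A' k" using xs n that by (auto simp: E_def W_def)
      then show ?thesis using that by (simp add: A'_def)
    qed
    then show "\<omega> \<in> prod_emb UNIV (\<lambda>_. K) J (Pi\<^sub>E J A)"
      using xs(2) by (auto simp: prod_emb_iff E_def space_PiM PiE_iff)
  qed
  moreover have "emeasure L (\<Union>xs\<in>W. E xs) = (\<Sum>xs\<in>W. emeasure L (E xs))"
    if "sets L = sets (Pi\<^sub>M UNIV (\<lambda>_. K))" for L
    using E that by (intro sum_emeasure[symmetric] disj W) auto
  moreover have "emeasure M (E xs) = emeasure N (E xs)" for xs
    unfolding E_def by (rule eq) (rule A')
  ultimately show "emeasure M (prod_emb UNIV (\<lambda>_. K) J (Pi\<^sub>E J A)) =
      emeasure N (prod_emb UNIV (\<lambda>_. K) J (Pi\<^sub>E J A))"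
    using M(2) N by simp
qed

abbreviation sequence_space :: "(nat \<Rightarrow> 'x) measure" where
  "sequence_space \<equiv> Pi\<^sub>M UNIV (\<lambda>_. count_space UNIV)"

lemma cyl_in_sets [measurable]: "cyl xs \<in> sets sequence_space"
proof -
  have "cyl xs = {\<omega> \<in> space sequence_space. \<forall>k<length xs. \<omega> k = xs ! k}"
    by (auto simp: cyl_def space_PiM)
  also have "\<dots> \<in> sets sequence_space" by measurable
  finally show ?thesis .
qed

lemma measure_eqI_cyl:
  fixes M N :: "(nat \<Rightarrow> 'x::finite) measure"
  assumes M: "prob_space M" "sets M = sets sequence_space"
    and N: "prob_space N" "sets N = sets sequence_space"
    and eq: "\<And>xs. measure M (cyl xs) = measure N (cyl xs)"
  shows "M = N"
proof (rule measure_eqI_words[OF M N(2), where c = "\<lambda>x. x"])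
  fix xs :: "'x list" and A :: "nat \<Rightarrow> 'x set"
  interpret M: prob_space M by fact
  interpret N: prob_space N by fact
  have "{\<omega> \<in> space sequence_space. \<forall>k<length xs. \<omega> k = xs ! k \<and> \<omega> k \<in> A k} =
      (if \<forall>k<length xs. xs ! k \<in> A k then cyl xs else {})"
    by (auto simp: cyl_def space_PiM)
  then show "emeasure M {\<omega> \<in> space sequence_space. \<forall>k<length xs. \<omega> k = xs ! k \<and> \<omega> k \<in> A k} =
      emeasure N {\<omega> \<in> space sequence_space. \<forall>k<length xs. \<omega> k = xs ! k \<and> \<omega> k \<in> A k}"
    by (simp add: M.emeasure_eq_measure N.emeasure_eq_measure eq)
qed simp

section \<open>Construction of the path measure\<close>

text \<open>\<open>F\<close> is a rule that chooses the next letter after each past;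
  \<open>history F n\<close> is the word that it produces in \<open>n\<close> steps.\<close>

primrec history :: "('x list \<Rightarrow> 'x) \<Rightarrow> nat \<Rightarrow> 'x list" where
  "history F 0 = []"
| "history F (Suc n) = history F n @ [F (history F n)]"

lemma length_history [simp]: "length (history F n) = n"
  by (induction n) auto

text \<open>As long as the produced word follows \<open>xs\<close>, its past is a prefix of
  \<open>xs\<close>. The recursive event thus becomes a condition on finitely many fixed coordinates
  of \<open>F\<close>.\<close>

lemma history_in_cyl_iff:
  "(\<lambda>n. F (history F n)) \<in> cyl xs \<longleftrightarrow> (\<forall>i<length xs. F (take i xs) = xs ! i)"
proof -
  have 1: "history F k = take k xs" if "k \<le> length xs" "\<forall>i<k. F (history F i) = xs ! i" for k
    using that by (induction k) (auto simp: take_Suc_conv_app_nth)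
  have 2: "history F k = take k xs" if "k \<le> length xs" "\<forall>i<k. F (take i xs) = xs ! i" for k
    using that by (induction k) (auto simp: take_Suc_conv_app_nth)
  show ?thesis
  proof
    assume "(\<lambda>n. F (history F n)) \<in> cyl xs"
    then have *: "\<forall>i<length xs. F (history F i) = xs ! i" by (simp add: cyl_def)
    then have "history F i = take i xs" if "i < length xs" for i using 1[of i] that by simp
    with * show "\<forall>i<length xs. F (take i xs) = xs ! i" by simp
  next
    assume *: "\<forall>i<length xs. F (take i xs) = xs ! i"
    then have "history F i = take i xs" if "i < length xs" for i using 2[of i] that by simp
    with * show "(\<lambda>n. F (history F n)) \<in> cyl xs" by (simp add: cyl_def)
  qed
qed

text \<open>A path is driven by an independent family of next letters \<open>F xs \<sim> P (w xs)\<close>, one for each possible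
  past \<open>xs\<close>; this yields the path measure as an image of a product measure.\<close>

lemma path_measure_exists:
  fixes u :: "'w \<Rightarrow> 'x::finite \<Rightarrow> 'w" and P :: "'w \<Rightarrow> 'x measure"
  assumes ker_prob: "\<And>v. prob_space (P v)" and ker_sets: "\<And>v. sets (P v) = UNIV"
  shows "\<exists>M. prob_space M \<and> sets M = sets sequence_space \<and> (\<forall>xs. measure M (cyl xs) = word_prob u P w xs)"
proof -
  define K where "K xs = P (foldl u w xs)" for xs
  interpret product_prob_space K UNIV
    by (rule product_prob_spaceI) (simp add: K_def ker_prob)
  have sets_K: "sets (K xs) = sets (count_space UNIV)" for xs
    by (simp add: K_def ker_sets)
  have comp [measurable]: "(\<lambda>F. F xs) \<in> Pi\<^sub>M UNIV K \<rightarrow>\<^sub>M count_space UNIV" for xs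
    using measurable_component_singleton[OF UNIV_I, of xs K]
    by (simp only: measurable_cong_sets[OF refl sets_K])
  \<comment> \<open>The index at which \<open>F\<close> is evaluated is itself random; measurability
    survives because there are only countably many words.\<close>
  have hist [measurable]: "(\<lambda>F. history F n) \<in> Pi\<^sub>M UNIV K \<rightarrow>\<^sub>M count_space UNIV" for n
  proof (induction n)
    case (Suc n)
    have "(\<lambda>F. xs @ [F xs]) \<in> Pi\<^sub>M UNIV K \<rightarrow>\<^sub>M count_space UNIV" for xs
      using measurable_compose[OF comp, of "\<lambda>y. xs @ [y]"] by simp
    from measurable_compose_countable[OF this Suc] show ?case by simp
  qed simp
  have [measurable]: "(\<lambda>F. F (history F n)) \<in> Pi\<^sub>M UNIV K \<rightarrow>\<^sub>M count_space UNIV" for n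
    using measurable_compose_countable[OF comp hist] .
  define T where "T F n = F (history F n)" for F :: "'x list \<Rightarrow> 'x" and n
  have T [measurable]: "T \<in> Pi\<^sub>M UNIV K \<rightarrow>\<^sub>M sequence_space"
    unfolding T_def[abs_def] by (intro measurable_PiM_single') auto
  have "measure (distr (Pi\<^sub>M UNIV K) sequence_space T) (cyl xs) = word_prob u P w xs" for xs
  proof -
    \<comment> \<open>The prefixes have different lengths, so they are distinct independent
      coordinates, and the length of a prefix recovers the position of the letter that follows
      it.\<close>
    define J where "J = (\<lambda>i. take i xs) ` {..<length xs}"
    have inj: "inj_on (\<lambda>i. take i xs) {..<length xs}"
      by (rule inj_onI) (metis length_take lessThan_iff less_imp_le min.absorb2)
    have "T F \<in> cyl xs \<longleftrightarrow> (\<forall>ys\<in>J. F ys \<in> {xs ! length ys})" for F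
      unfolding T_def[abs_def] history_in_cyl_iff by (auto simp: J_def)
    then have "T -` cyl xs \<inter> space (Pi\<^sub>M UNIV K) = {F \<in> space (Pi\<^sub>M UNIV K). \<forall>ys\<in>J. F ys \<in> {xs ! length ys}}"
      by auto
    then have "emeasure (distr (Pi\<^sub>M UNIV K) sequence_space T) (cyl xs) =
        emeasure (Pi\<^sub>M UNIV K) {F \<in> space (Pi\<^sub>M UNIV K). \<forall>ys\<in>J. F ys \<in> {xs ! length ys}}"
      by (subst emeasure_distr[OF T cyl_in_sets]) (simp only:)
    also have "\<dots> = (\<Prod>ys\<in>J. emeasure (K ys) {xs ! length ys})"
      by (rule emeasure_PiM_Collect) (auto simp: J_def sets_K)
    also have "\<dots> = (\<Prod>i<length xs. emeasure (K (take i xs)) {xs ! i})"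
      unfolding J_def by (subst prod.reindex[OF inj]) (auto intro!: prod.cong)
    also have "\<dots> = ennreal (word_prob u P w xs)"
      by (simp add: word_prob_def prod_ennreal K_def
          finite_measure.emeasure_eq_measure[OF prob_space.axioms(1)[OF ker_prob]])
    finally show ?thesis
      by (simp add: measure_def word_prob_def prod_nonneg)
  qed
  then show ?thesis using P.prob_space_distr[OF T] by (intro exI[of _ "distr (Pi\<^sub>M UNIV K) sequence_space T"]) simp
qed

lemma
  fixes u :: "'w \<Rightarrow> 'x::finite \<Rightarrow> 'w" and P :: "'w \<Rightarrow> 'x measure"
  assumes "\<And>v. prob_space (P v)" and "\<And>v. sets (P v) = UNIV"
  shows prob_space_path_measure: "prob_space (path_measure u P w)"
    and sets_path_measure: "sets (path_measure u P w) = sets sequence_space"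
proof -
  have "\<exists>!M. prob_space M \<and> sets M = sets sequence_space \<and> (\<forall>xs. measure M (cyl xs) = word_prob u P w xs)"
    using path_measure_exists[where u = u and P = P and w = w, OF assms] by (blast intro: measure_eqI_cyl[OF _ _ _ _ trans[OF _ sym]])
  then have "prob_space (path_measure u P w) \<and> sets (path_measure u P w) = sets sequence_space \<and>
      (\<forall>xs. measure (path_measure u P w) (cyl xs) = word_prob u P w xs)"
    unfolding path_measure_def by (rule theI')
  then show "prob_space (path_measure u P w)" "sets (path_measure u P w) = sets sequence_space" by auto
qed

section \<open>Topological supports\<close>

lemma openin_cyl: "openin (product_topology (\<lambda>_. discrete_topology UNIV) UNIV) (cyl xs)"
proof -
  have "cyl xs = Pi\<^sub>E UNIV (\<lambda>i. if i < length xs then {xs ! i} else UNIV)"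
    by (auto simp: cyl_def PiE_iff split: if_splits)
  moreover have "finite {i. (if i < length xs then {xs ! i} else UNIV) \<noteq> UNIV}"
    by (rule finite_subset[of _ "{..<length xs}"]) auto
  ultimately show ?thesis by (simp add: product_topology_basis)
qed

lemma cyl_subset_openin:
  assumes "openin (product_topology (\<lambda>_. discrete_topology UNIV) UNIV) U" "\<omega> \<in> U"
  obtains xs where "\<omega> \<in> cyl xs" "cyl xs \<subseteq> U"
proof -
  obtain V where V: "finite {i. V i \<noteq> UNIV}" "\<omega> \<in> Pi\<^sub>E UNIV V" "Pi\<^sub>E UNIV V \<subseteq> U"
    using assms unfolding openin_product_topology_alt by auto
  obtain n where n: "{i. V i \<noteq> UNIV} \<subseteq> {..<n}" using finite_nat_iff_bounded V(1) by blast
  have "cyl (map \<omega> [0..<n]) \<subseteq> Pi\<^sub>E UNIV V"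
  proof
    fix \<omega>' assume *: "\<omega>' \<in> cyl (map \<omega> [0..<n])"
    have "\<omega>' i \<in> V i" for i
    proof (cases "i < n")
      case True
      then show ?thesis using * V(2) by (auto simp: cyl_def)
    next
      case False
      then show ?thesis using n by blast
    qed
    then show "\<omega>' \<in> Pi\<^sub>E UNIV V" by auto
  qed
  then show thesis using that[of "map \<omega> [0..<n]"] V(3) by (auto simp: cyl_def)
qed

text \<open>Cylinders form a base, and open sets are countable unions of them, hence measurable, so
  monotonicity applies. Membership in the support becomes countably many conditions, from which the
  measurability of \<open>Xi\<close> follows.\<close>

lemma topological_support_sequence_space:
  fixes M :: "(nat \<Rightarrow> 'x::countable) measure"
  assumes "prob_space M" and sets_M: "sets M = sets sequence_space"
  shows "topological_support (product_topology (\<lambda>_. discrete_topology UNIV) UNIV) M =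
    {\<omega>. \<forall>xs. \<omega> \<in> cyl xs \<longrightarrow> 0 < measure M (cyl xs)}" (is "?S = ?T")
proof -
  interpret prob_space M by fact
  show ?thesis
  proof (intro equalityI subsetI)
    fix \<omega> assume "\<omega> \<in> ?S"
    then show "\<omega> \<in> ?T"
      using openin_cyl by (auto simp: topological_support_def emeasure_eq_measure)
  next
    fix \<omega> assume \<omega>: "\<omega> \<in> ?T"
    have "0 < emeasure M U"
      if U: "openin (product_topology (\<lambda>_. discrete_topology UNIV) UNIV) U" "\<omega> \<in> U" for U
    proof -
      have "U = \<Union>(cyl ` {xs. cyl xs \<subseteq> U})" using cyl_subset_openin[OF U(1)] by blast
      also have "\<dots> \<in> sets M" unfolding sets_M by (intro sets.countable_UN' cyl_in_sets) auto
      finally have "U \<in> sets M" .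
      moreover obtain xs where "\<omega> \<in> cyl xs" "cyl xs \<subseteq> U" using cyl_subset_openin[OF U] .
      ultimately have "emeasure M (cyl xs) \<le> emeasure M U" "0 < measure M (cyl xs)"
        using \<omega> by (auto intro: emeasure_mono)
      then show ?thesis by (simp add: emeasure_eq_measure)
    qed
    then show "\<omega> \<in> ?S" by (auto simp: topological_support_def)
  qed
qed

lemma closed_topological_support: "closed (topological_support euclidean M)"
proof -
  have "- topological_support euclidean M = \<Union>{U. open U \<and> emeasure M U = 0}"
    by (auto simp: topological_support_def not_less)
  then show ?thesis by (auto simp: closed_def)
qed

text \<open>The complement of the support is the union of all open null sets; by the Lindelof
  property countably many of them suffice, so it is null.\<close>

lemma AE_in_topological_support:
  fixes M :: "'a::second_countable_topology measure"
  assumes "sets M = sets borel"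
  shows "AE x in M. x \<in> topological_support euclidean M"
proof -
  obtain F where F: "F \<subseteq> {U. open U \<and> emeasure M U = 0}" "countable F" "\<Union>F = \<Union>{U. open U \<and> emeasure M U = 0}"
    using Lindelof[of "{U. open U \<and> emeasure M U = 0}"] by auto
  have "\<forall>U\<in>F. AE x in M. x \<notin> U"
    using F(1) assms by (auto intro!: AE_not_in simp: null_sets_def)
  then have "AE x in M. \<forall>U\<in>F. x \<notin> U" using F(2) by (simp add: AE_ball_countable)
  moreover have "x \<in> topological_support euclidean M" if "\<forall>U\<in>F. x \<notin> U" for x
  proof -
    have "x \<notin> \<Union>{U. open U \<and> emeasure M U = 0}" using that F(3) by blast
    then show ?thesis by (auto simp: topological_support_def zero_less_iff_neq_zero)
  qed
  ultimately show ?thesis by auto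
qed

section \<open>The measure on marked paths\<close>

abbreviation marked_space :: "(nat \<Rightarrow> poly_map \<times> 'x) measure" where
  "marked_space \<equiv> Pi\<^sub>M UNIV (\<lambda>_. borel \<Otimes>\<^sub>M count_space UNIV)"

lemma space_marked_space [simp]: "space marked_space = UNIV"
  by (simp add: space_PiM space_pair_measure)

lemma measurable_mark [measurable]:
  "(\<lambda>\<omega>. fst (\<omega> k)) \<in> marked_space \<rightarrow>\<^sub>M borel" "(\<lambda>\<omega>. snd (\<omega> k)) \<in> marked_space \<rightarrow>\<^sub>M count_space UNIV"
  by measurable

definition marked_cyl :: "'x list \<Rightarrow> (nat \<Rightarrow> poly_map set) \<Rightarrow> (nat \<Rightarrow> poly_map \<times> 'x) set" where
  "marked_cyl xs A = {\<omega>. \<forall>k<length xs. snd (\<omega> k) = xs ! k \<and> fst (\<omega> k) \<in> A k}"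

lemma marked_cyl_in_sets:
  assumes "\<And>k. k < length xs \<Longrightarrow> A k \<in> sets borel"
  shows "marked_cyl xs A \<in> sets marked_space"
proof -
  have "marked_cyl xs A =
      {\<omega> \<in> space marked_space. \<forall>k\<in>{..<length xs}. snd (\<omega> k) = xs ! k \<and> fst (\<omega> k) \<in> A k}"
    by (auto simp: marked_cyl_def)
  also have "\<dots> \<in> sets marked_space"
  proof (intro sets.sets_Collect_finite_All)
    fix k assume "k \<in> {..<length xs}"
    then have [measurable]: "A k \<in> sets borel" using assms by simp
    show "{\<omega> \<in> space marked_space. snd (\<omega> k) = xs ! k \<and> fst (\<omega> k) \<in> A k} \<in> sets marked_space"
      by measurable
  qed simp
  finally show ?thesis .
qed

text \<open>Once the letter at time k is fixed, only the section of \<open>A k\<close> over that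
  letter matters, and sections of measurable sets are Borel.\<close>

lemma measure_eqI_marked_cyl:
  fixes M N :: "(nat \<Rightarrow> poly_map \<times> 'x::finite) measure"
  assumes M: "prob_space M" "sets M = sets marked_space"
    and N: "prob_space N" "sets N = sets marked_space"
    and eq: "\<And>xs A. (\<And>k. A k \<in> sets borel) \<Longrightarrow> measure M (marked_cyl xs A) = measure N (marked_cyl xs A)"
  shows "M = N"
proof (rule measure_eqI_words[OF M N(2), where c = snd])
  fix xs :: "'x list" and A :: "nat \<Rightarrow> (poly_map \<times> 'x) set"
  assume A: "\<And>k. A k \<in> sets (borel \<Otimes>\<^sub>M count_space UNIV)"
  interpret M: prob_space M by fact
  interpret N: prob_space N by fact
  have "{\<omega> \<in> space marked_space. \<forall>k<length xs. snd (\<omega> k) = xs ! k \<and> \<omega> k \<in> A k} =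
      marked_cyl xs (\<lambda>k. (\<lambda>f. (f, xs ! k)) -` A k)"
    by (auto simp: marked_cyl_def) (metis prod.collapse)+
  then show "emeasure M {\<omega> \<in> space marked_space. \<forall>k<length xs. snd (\<omega> k) = xs ! k \<and> \<omega> k \<in> A k} =
      emeasure N {\<omega> \<in> space marked_space. \<forall>k<length xs. snd (\<omega> k) = xs ! k \<and> \<omega> k \<in> A k}"
    using eq sets_Pair2[OF A] by (simp add: M.emeasure_eq_measure N.emeasure_eq_measure)
qed simp

locale random_polynomial_system =
  fixes u :: "'w \<Rightarrow> 'x::finite \<Rightarrow> 'w" and P :: "'w \<Rightarrow> 'x measure"
    and \<tau> :: "'x \<Rightarrow> poly_map measure" and w :: 'w
  assumes ker_prob: "\<And>v. prob_space (P v)" and ker_sets: "\<And>v. sets (P v) = UNIV"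
    and tau_prob: "\<And>x. prob_space (\<tau> x)" and tau_sets: "\<And>x. sets (\<tau> x) = sets borel"
begin

abbreviation "Pw \<equiv> path_measure u P w"
abbreviation "Xiw \<equiv> Xi u P \<tau> w"

lemmas prob_space_Pw = prob_space_path_measure[where u = u and P = P and w = w, OF ker_prob ker_sets]
lemmas sets_Pw = sets_path_measure[where u = u and P = P and w = w, OF ker_prob ker_sets]
lemmas support_Pw = topological_support_sequence_space[OF prob_space_Pw sets_Pw]

lemma Xi_eq: "Xiw = {\<omega>. (\<forall>xs. (\<lambda>n. snd (\<omega> n)) \<in> cyl xs \<longrightarrow> xs \<in> admissible_words u P w (length xs)) \<and>
    (\<forall>n. fst (\<omega> n) \<in> Gamma_set \<tau> (snd (\<omega> n)))}"
  by (simp add: Xi_def support_Pw admissible_words_def)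

lemma Gamma_set_in_sets [measurable]: "Gamma_set \<tau> x \<in> sets borel"
  unfolding Gamma_set_def by (rule borel_closed) (rule closed_topological_support)

lemma AE_Gamma_set: "AE f in \<tau> x. f \<in> Gamma_set \<tau> x"
  unfolding Gamma_set_def by (rule AE_in_topological_support) (rule tau_sets)

text \<open>The description of \<open>tau_tilde\<close> admits only subsets of the supports; this
  equality extends its cylinder formula to arbitrary Borel sets.\<close>

lemma measure_Int_Gamma_set:
  assumes "A \<in> sets borel"
  shows "measure (\<tau> x) (A \<inter> Gamma_set \<tau> x) = measure (\<tau> x) A"
  using AE_Gamma_set[of x] assms Gamma_set_in_sets[of x]
  by (intro measure_eq_AE) (auto simp: tau_sets)

lemma measurable_snd_path [measurable]:
  "(\<lambda>\<omega> n. snd (\<omega> n)) \<in> (marked_space :: (nat \<Rightarrow> poly_map \<times> 'x) measure) \<rightarrow>\<^sub>M sequence_space"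
  by (intro measurable_PiM_single') auto

lemma Xi_in_sets: "Xiw \<in> sets marked_space"
proof -
  \<comment> \<open>The letter at time \<open>n\<close> is replaced by a quantified
    \<open>x\<close>, so that each condition involves one fixed Borel set and there are countably
    many of them.\<close>
  have "Xiw = {\<omega> \<in> space marked_space. (\<forall>xs. (\<lambda>n. snd (\<omega> n)) \<in> cyl xs \<longrightarrow> xs \<in> admissible_words u P w (length xs)) \<and>
    (\<forall>n x. snd (\<omega> n) = x \<longrightarrow> fst (\<omega> n) \<in> Gamma_set \<tau> x)}"
    unfolding Xi_eq by auto
  also have "\<dots> \<in> sets marked_space"
    by measurable
  finally show ?thesis .
qed

text \<open>The marks \<open>\<gamma>\<^sub>k\<close> are read off from an independent family \<open>G (k, x) \<sim> \<tau> x\<close> over all times and letters,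
  drawn independently of the path; at time \<open>k\<close> only the entry at the current letter is used.\<close>

definition driving_measure :: "((nat \<Rightarrow> 'x) \<times> (nat \<times> 'x \<Rightarrow> poly_map)) measure" where
  "driving_measure = Pw \<Otimes>\<^sub>M Pi\<^sub>M UNIV (\<lambda>j. \<tau> (snd j))"

definition mark :: "(nat \<Rightarrow> 'x) \<times> (nat \<times> 'x \<Rightarrow> poly_map) \<Rightarrow> nat \<Rightarrow> poly_map \<times> 'x" where
  "mark p k = (snd p (k, fst p k), fst p k)"

definition marked_measure :: "(nat \<Rightarrow> poly_map \<times> 'x) measure" where
  "marked_measure = distr driving_measure marked_space mark"

sublocale marks: product_prob_space "\<lambda>j :: nat \<times> 'x. \<tau> (snd j)" UNIV
  by (rule product_prob_spaceI) (rule tau_prob)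

sublocale driving: pair_prob_space Pw "Pi\<^sub>M UNIV (\<lambda>j :: nat \<times> 'x. \<tau> (snd j))"
proof -
  interpret Pw: prob_space Pw by (rule prob_space_Pw)
  show "pair_prob_space Pw (Pi\<^sub>M UNIV (\<lambda>j :: nat \<times> 'x. \<tau> (snd j)))" by unfold_locales
qed

lemma measurable_mark_map [measurable]: "mark \<in> driving_measure \<rightarrow>\<^sub>M marked_space"
proof -
  have x [measurable]: "(\<lambda>p. fst p k) \<in> driving_measure \<rightarrow>\<^sub>M count_space UNIV" for k
    unfolding driving_measure_def
    by (rule measurable_compose[OF measurable_fst], subst measurable_cong_sets[OF sets_Pw refl]) measurable
  have G: "(\<lambda>p. snd p j) \<in> driving_measure \<rightarrow>\<^sub>M borel" for j
    unfolding driving_measure_def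
    using measurable_compose[OF measurable_snd measurable_component_singleton[OF UNIV_I, of j "\<lambda>j. \<tau> (snd j)"]]
    by (simp only: measurable_cong_sets[OF refl tau_sets])
  have [measurable]: "(\<lambda>p. snd p (k, fst p k)) \<in> driving_measure \<rightarrow>\<^sub>M borel" for k
    by (rule measurable_compose_countable[where f = "\<lambda>x p. snd p (k, x)", OF G x])
  show ?thesis
    unfolding mark_def[abs_def] by (intro measurable_PiM_single') (auto simp: space_pair_measure)
qed

lemma prob_space_marked_measure: "prob_space marked_measure"
  unfolding marked_measure_def
  using driving.prob_space_distr[of mark] measurable_mark_map by (simp add: driving_measure_def)

lemma sets_marked_measure [simp]: "sets marked_measure = sets marked_space"
  by (simp add: marked_measure_def)

text \<open>On \<open>cyl xs\<close> the letters are known, so \<open>mark\<close> reads the entries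
  (k, xs ! k), which are distinct because of \<open>k\<close>. The preimage is therefore a
  rectangle, and independence gives the product.\<close>

lemma measure_marked_cyl:
  assumes A: "\<And>k. k < length xs \<Longrightarrow> A k \<in> sets borel"
  shows "measure marked_measure (marked_cyl xs A) =
    measure Pw (cyl xs) * (\<Prod>k<length xs. measure (\<tau> (xs ! k)) (A k))"
proof -
  let ?Q = "Pi\<^sub>M UNIV (\<lambda>j :: nat \<times> 'x. \<tau> (snd j))"
  define J where "J = (\<lambda>k. (k, xs ! k)) ` {..<length xs}"
  define B where "B = {G \<in> space ?Q. \<forall>j\<in>J. G j \<in> A (fst j)}"
  have AJ: "A (fst j) \<in> sets (\<tau> (snd j))" if "j \<in> J" for j
    using that A by (auto simp: J_def tau_sets)
  have sp: "space Pw = UNIV" "space ?Q = UNIV"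
    using sets_eq_imp_space_eq[OF sets_Pw] sets_eq_imp_space_eq[OF tau_sets]
    by (auto simp: space_PiM PiE_def)
  have B: "B \<in> sets ?Q"
    unfolding B_def by (intro sets.sets_Collect_finite_All sets_Collect_single' ) (use AJ in \<open>auto simp: J_def\<close>)
  have "emeasure ?Q B = (\<Prod>j\<in>J. emeasure (\<tau> (snd j)) (A (fst j)))"
    unfolding B_def by (rule marks.emeasure_PiM_Collect) (use AJ in \<open>auto simp: J_def\<close>)
  also have "\<dots> = (\<Prod>k<length xs. emeasure (\<tau> (xs ! k)) (A k))"
    unfolding J_def by (subst prod.reindex) (auto simp: inj_on_def)
  also have "\<dots> = ennreal (\<Prod>k<length xs. measure (\<tau> (xs ! k)) (A k))"
    by (simp add: prod_ennreal finite_measure.emeasure_eq_measure[OF prob_space.axioms(1)[OF tau_prob]])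
  finally have QB: "measure ?Q B = (\<Prod>k<length xs. measure (\<tau> (xs ! k)) (A k))"
    by (simp add: measure_def prod_nonneg)
  have "mark -` marked_cyl xs A \<inter> space driving_measure = cyl xs \<times> B"
    by (auto simp: driving_measure_def space_pair_measure sp marked_cyl_def mark_def cyl_def B_def J_def)
  then have "emeasure marked_measure (marked_cyl xs A) = emeasure driving_measure (cyl xs \<times> B)"
    unfolding marked_measure_def by (simp add: emeasure_distr marked_cyl_in_sets A)
  also have "\<dots> = emeasure Pw (cyl xs) * emeasure ?Q B"
    unfolding driving_measure_def by (rule marks.P.emeasure_pair_measure_Times) (use B sets_Pw cyl_in_sets in auto)
  finally show ?thesis unfolding QB[symmetric] by (simp add: measure_def enn2real_mult)
qed

text \<open>A path can miss \<open>Xi\<close> only by entering one of countably many cylinders of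
  measure zero or by a mark outside its support at one of countably many indices.\<close>

lemma AE_marked_measure_Xi: "AE \<omega> in marked_measure. \<omega> \<in> Xiw"
proof -
  let ?Q = "Pi\<^sub>M UNIV (\<lambda>j :: nat \<times> 'x. \<tau> (snd j))"
  have "AE G in ?Q. \<forall>j. G j \<in> Gamma_set \<tau> (snd j)"
    using AE_Gamma_set by (subst AE_all_countable) (intro allI marks.AE_component, auto)
  moreover have "AE x in Pw. \<forall>xs. x \<in> cyl xs \<longrightarrow> xs \<in> admissible_words u P w (length xs)"
  proof (subst AE_all_countable, intro allI)
    fix xs :: "'x list"
    show "AE x in Pw. x \<in> cyl xs \<longrightarrow> xs \<in> admissible_words u P w (length xs)"
    proof (cases "measure Pw (cyl xs) = 0")
      case True
      then have "cyl xs \<in> null_sets Pw"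
        by (auto simp: null_sets_def sets_Pw driving.M1.emeasure_eq_measure)
      then have "AE x in Pw. x \<notin> cyl xs" by (rule AE_not_in)
      then show ?thesis by eventually_elim simp
    next
      case False
      then show ?thesis by (simp add: admissible_words_def less_le)
    qed
  qed
  ultimately have "AE x in Pw. AE G in ?Q. mark (x, G) \<in> Xiw"
    by (auto elim!: eventually_mono simp: Xi_eq mark_def)
  then have "AE p in driving_measure. mark p \<in> Xiw"
    unfolding driving_measure_def
    by (rule driving.AE_pair_measure[rotated])
      (use measurable_sets[OF measurable_mark_map Xi_in_sets] in
        \<open>simp add: driving_measure_def vimage_def Int_def conj_commute\<close>)
  then show ?thesis
    unfolding marked_measure_def using Xi_in_sets by (subst AE_distr_iff) auto
qed

text \<open>Restriction to \<open>Xi\<close>, a set of full measure, preserves total mass and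
  cylinder values, which gives existence. For uniqueness, a candidate is determined on cylinders
  over admissible words after intersection with the supports, and cylinders over other words do not
  meet \<open>Xi\<close>.\<close>

lemma tau_tilde_eq: "tau_tilde u P \<tau> w = restrict_space marked_measure Xiw"
proof -
  interpret N: prob_space marked_measure by (rule prob_space_marked_measure)
  have set_eq: "{\<omega> \<in> Xiw. \<forall>k<length xs. snd (\<omega> k) = xs ! k \<and> fst (\<omega> k) \<in> A k} = Xiw \<inter> marked_cyl xs A"
    for xs A by (auto simp: marked_cyl_def)
  show ?thesis
    unfolding tau_tilde_def
  proof (rule the_equality, intro conjI allI ballI impI)
    show "prob_space (restrict_space marked_measure Xiw)"
      using Xi_in_sets AE_marked_measure_Xi by (intro prob_space_restrict_space N.emeasure_eq_1_AE) auto
    show "sets (restrict_space marked_measure Xiw) = sets (restrict_space marked_space Xiw)"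
      by (rule sets_restrict_space_cong) simp
  next
    fix n xs A
    assume xs: "xs \<in> admissible_words u P w n"
      and A: "\<forall>k<n. A k \<in> sets borel \<and> A k \<subseteq> Gamma_set \<tau> (xs ! k)"
    have n: "n = length xs" using xs by (simp add: admissible_words_def)
    have "measure (restrict_space marked_measure Xiw) (Xiw \<inter> marked_cyl xs A) =
        measure marked_measure (Xiw \<inter> marked_cyl xs A)"
      using Xi_in_sets by (intro measure_restrict_space) auto
    also have "\<dots> = measure marked_measure (marked_cyl xs A)"
      using AE_marked_measure_Xi Xi_in_sets A by (intro measure_eq_AE) (auto simp: n marked_cyl_in_sets)
    finally show "measure (restrict_space marked_measure Xiw)
        {\<omega> \<in> Xiw. \<forall>k<n. snd (\<omega> k) = xs ! k \<and> fst (\<omega> k) \<in> A k} =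
        measure Pw (cyl xs) * (\<Prod>k<n. measure (\<tau> (xs ! k)) (A k))"
      using A unfolding n set_eq by (simp add: measure_marked_cyl)
  next
    fix M
    assume "prob_space M \<and> sets M = sets (restrict_space marked_space Xiw) \<and>
      (\<forall>n. \<forall>xs\<in>admissible_words u P w n. \<forall>A. (\<forall>k<n. A k \<in> sets borel \<and> A k \<subseteq> Gamma_set \<tau> (xs ! k)) \<longrightarrow>
        measure M {\<omega> \<in> Xiw. \<forall>k<n. snd (\<omega> k) = xs ! k \<and> fst (\<omega> k) \<in> A k} =
        measure Pw (cyl xs) * (\<Prod>k<n. measure (\<tau> (xs ! k)) (A k)))"
    then have M: "prob_space M" and sets_M: "sets M = sets (restrict_space marked_space Xiw)"
      and cyl_M: "\<And>n xs A. xs \<in> admissible_words u P w n \<Longrightarrow>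
        (\<And>k. k < n \<Longrightarrow> A k \<in> sets borel \<and> A k \<subseteq> Gamma_set \<tau> (xs ! k)) \<Longrightarrow>
        measure M {\<omega> \<in> Xiw. \<forall>k<n. snd (\<omega> k) = xs ! k \<and> fst (\<omega> k) \<in> A k} =
        measure Pw (cyl xs) * (\<Prod>k<n. measure (\<tau> (xs ! k)) (A k))" by auto
    interpret M: prob_space M by fact
    have space_M: "space M = Xiw"
      using sets_eq_imp_space_eq[OF sets_M] by (simp add: space_restrict_space)
    have id: "(\<lambda>\<omega>. \<omega>) \<in> M \<rightarrow>\<^sub>M marked_space"
      by (subst measurable_cong_sets[OF sets_M refl])
        (rule measurable_restrict_space1, rule measurable_ident_sets[OF refl])
    \<comment> \<open>Uniqueness is shown on the whole sequence space, where the cylinders generate.\<close>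
    have "distr M marked_space (\<lambda>\<omega>. \<omega>) = marked_measure"
    proof (rule measure_eqI_marked_cyl)
      fix xs :: "'x list" and A :: "nat \<Rightarrow> poly_map set"
      assume A: "\<And>k. A k \<in> sets borel"
      have "measure (distr M marked_space (\<lambda>\<omega>. \<omega>)) (marked_cyl xs A) = measure M (Xiw \<inter> marked_cyl xs A)"
        by (simp add: measure_distr[OF id] marked_cyl_in_sets A space_M Int_commute)
      also have "\<dots> = measure Pw (cyl xs) * (\<Prod>k<length xs. measure (\<tau> (xs ! k)) (A k))"
      proof (cases "xs \<in> admissible_words u P w (length xs)")
        case True
        have "Xiw \<inter> marked_cyl xs A = {\<omega> \<in> Xiw. \<forall>k<length xs.
            snd (\<omega> k) = xs ! k \<and> fst (\<omega> k) \<in> A k \<inter> Gamma_set \<tau> (xs ! k)}"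
          by (auto simp: Xi_eq marked_cyl_def) metis
        then show ?thesis
          using cyl_M[OF True, of "\<lambda>k. A k \<inter> Gamma_set \<tau> (xs ! k)"] A by (simp add: measure_Int_Gamma_set)
      next
        case False
        then have "Xiw \<inter> marked_cyl xs A = {}" by (auto simp: Xi_eq marked_cyl_def cyl_def)
        moreover have "measure Pw (cyl xs) = 0"
          using False by (simp add: admissible_words_def less_le)
        ultimately show ?thesis by simp
      qed
      also have "\<dots> = measure marked_measure (marked_cyl xs A)" by (simp add: measure_marked_cyl A)
      finally show "measure (distr M marked_space (\<lambda>\<omega>. \<omega>)) (marked_cyl xs A) =
          measure marked_measure (marked_cyl xs A)" .
    qed (auto intro: M.prob_space_distr[OF id] prob_space_marked_measure)
    then have *: "emeasure marked_measure S = emeasure M (S \<inter> Xiw)" if "S \<in> sets marked_space" for S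
      using emeasure_distr[OF id that] by (simp add: space_M)
    show "M = restrict_space marked_measure Xiw"
    proof (rule measure_eqI)
      show "sets M = sets (restrict_space marked_measure Xiw)"
        unfolding sets_M by (rule sets_restrict_space_cong) simp
      fix S assume "S \<in> sets M"
      then have S: "S \<in> sets marked_space" "S \<subseteq> Xiw"
        using Xi_in_sets by (auto simp: sets_M sets_restrict_space)
      then show "emeasure M S = emeasure (restrict_space marked_measure Xiw) S"
        using Xi_in_sets by (subst emeasure_restrict_space) (auto simp: * Int_absorb2)
    qed
  qed
qed

lemma measure_tau_tilde:
  assumes "E \<in> sets marked_space"
  shows "measure (tau_tilde u P \<tau> w) (Xiw \<inter> E) = measure marked_measure E"
proof -
  have "measure (tau_tilde u P \<tau> w) (Xiw \<inter> E) = measure marked_measure (Xiw \<inter> E)"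
    unfolding tau_tilde_eq using Xi_in_sets by (intro measure_restrict_space) auto
  also have "\<dots> = measure marked_measure E"
    using AE_marked_measure_Xi Xi_in_sets assms by (intro measure_eq_AE) auto
  finally show ?thesis .
qed

text \<open>An open set that meets a support has positive mass by definition of the support, and the
  cylinder formula is a finite product of such masses.\<close>

lemma measure_marked_cyl_pos:
  assumes "xs \<in> admissible_words u P w n"
    and "\<And>k. k < n \<Longrightarrow> open (U k)" "\<And>k. k < n \<Longrightarrow> U k \<inter> Gamma_set \<tau> (xs ! k) \<noteq> {}"
  shows "0 < measure marked_measure (marked_cyl xs U)"
proof -
  have n: "n = length xs" and pos: "0 < measure Pw (cyl xs)"
    using assms(1) by (simp_all add: admissible_words_def)
  have "0 < measure (\<tau> (xs ! k)) (U k)" if "k < n" for k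
  proof -
    interpret prob_space "\<tau> (xs ! k)" by (rule tau_prob)
    have "0 < emeasure (\<tau> (xs ! k)) (U k)"
      using assms(2,3)[OF that] by (auto simp: Gamma_set_def topological_support_def)
    then show ?thesis by (simp add: emeasure_eq_measure)
  qed
  then show ?thesis
    using pos assms(2) unfolding n by (subst measure_marked_cyl) (auto intro!: mult_pos_pos prod_pos)
qed

end

section \<open>Orbits and the escaping probability\<close>

lemma mem_ball_Infty_iff:
  assumes "0 \<le> R"
  shows "v \<in> ball Infty (dist Infty (Fin (of_real R))) \<longleftrightarrow> (\<forall>a. v = Fin a \<longrightarrow> R < cmod a)"
  using assms by (cases v) (auto simp: dist_Infty_less_iff)

text \<open>Past the radius the modulus doubles at every step, so a single entry into the ball
  already forces escape. An orbit at \<open>Infty\<close> stays there.\<close>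

lemma compose_upto_tendsto_Infty_iff:
  assumes R: "1 \<le> R"
    and esc: "\<And>n z. R \<le> cmod z \<Longrightarrow> 2 * cmod z \<le> cmod (poly (poly_of (g n)) z)"
  shows "(\<lambda>n. compose_upto g n v) \<longlonglongrightarrow> Infty \<longleftrightarrow>
    (\<exists>n. compose_upto g n v \<in> ball Infty (dist Infty (Fin (of_real R))))"
proof
  assume "(\<lambda>n. compose_upto g n v) \<longlonglongrightarrow> Infty"
  then have "\<forall>\<^sub>F n in sequentially. compose_upto g n v \<in> ball Infty (dist Infty (Fin (of_real R)))"
    by (rule topological_tendstoD) auto
  then show "\<exists>n. compose_upto g n v \<in> ball Infty (dist Infty (Fin (of_real R)))"
    by (auto simp: eventually_sequentially)
next
  assume "\<exists>n. compose_upto g n v \<in> ball Infty (dist Infty (Fin (of_real R)))"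
  then obtain m where "compose_upto g m v \<in> ball Infty (dist Infty (Fin (of_real R)))" ..
  then have m: "R \<le> cmod a" if "compose_upto g m v = Fin a" for a
    using that R by (subst (asm) mem_ball_Infty_iff) (auto intro: less_imp_le)
  \<comment> \<open>A finite iterate has a finite predecessor since \<open>Infty\<close> is fixed,
    so the induction never has to treat \<open>Infty\<close>.\<close>
  have grow: "2 ^ k * R \<le> cmod a" if "compose_upto g (m + k) v = Fin a" for k a
    using that
  proof (induction k arbitrary: a)
    case 0
    then show ?case using m by simp
  next
    case (Suc k)
    then obtain b where b: "compose_upto g (m + k) v = Fin b" "a = poly (poly_of (g (m + k))) b"
      by (cases "compose_upto g (m + k) v") auto
    have ge: "2 ^ k * R \<le> cmod b" using Suc.IH[OF b(1)] .
    have "1 * R \<le> 2 ^ k * R" using R by (intro mult_right_mono) auto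
    then have "2 * cmod b \<le> cmod a" using ge esc b(2) by simp
    then show ?case using ge by simp
  qed
  show "(\<lambda>n. compose_upto g n v) \<longlonglongrightarrow> Infty"
  proof (rule metric_LIMSEQ_I)
    fix e :: real assume e: "0 < e"
    obtain K where K: "6 / e < 2 ^ K" using real_arch_pow[of 2 "6 / e"] by auto
    have "dist (compose_upto g n v) Infty < e" if n: "m + K \<le> n" for n
    proof (cases "compose_upto g n v")
      case (Fin a)
      then have "2 ^ (n - m) * R \<le> cmod a" using grow[of "n - m" a] n by simp
      moreover have "(2::real) ^ K * 1 \<le> 2 ^ (n - m) * R"
        using n R by (intro mult_mono power_increasing) auto
      ultimately have "6 / e \<le> cmod a" using K by simp
      then show ?thesis using dist_Infty_Fin_lt[OF e] Fin by (simp add: dist_commute)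
    qed (use e in simp)
    then show "\<exists>no. \<forall>n\<ge>no. dist (compose_upto g n v) Infty < e" by blast
  qed
qed

section \<open>Stability and measurability of finite compositions\<close>

text \<open>Joint continuity of the last factor gives a product neighbourhood
  \<open>A \<times> B\<close> inside the preimage of \<open>V\<close>: \<open>A\<close> restricts
  the last map, and \<open>B\<close> is the target for the shorter composition.\<close>

lemma compose_upto_open_box:
  assumes "open V" "compose_upto g n v \<in> V"
  obtains U where "\<And>k. open (U k)" "\<And>k. g k \<in> U k"
    "\<And>h. (\<And>k. k < n \<Longrightarrow> h k \<in> U k) \<Longrightarrow> compose_upto h n v \<in> V"
  using assms
proof (induction n arbitrary: V thesis)
  case 0
  then show ?case by (intro "0.prems"(1)[of "\<lambda>_. UNIV"]) auto
next
  case (Suc n)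
  let ?S = "(\<lambda>(f, v). apply_poly f v) -` V"
  have "open ?S" by (rule open_vimage[OF Suc.prems(2) continuous_on_apply_poly])
  moreover have "(g n, compose_upto g n v) \<in> ?S" using Suc.prems(3) by simp
  ultimately obtain A B where AB: "open A" "open B" "(g n, compose_upto g n v) \<in> A \<times> B" "A \<times> B \<subseteq> ?S"
    by (rule open_prod_elim)
  then have "compose_upto g n v \<in> B" by simp
  from Suc.IH[OF _ AB(2) this] obtain U where U: "\<And>k. open (U k)" "\<And>k. g k \<in> U k"
    "\<And>h. (\<And>k. k < n \<Longrightarrow> h k \<in> U k) \<Longrightarrow> compose_upto h n v \<in> B" by blast
  show ?case
  proof (rule Suc.prems(1)[of "U(n := U n \<inter> A)"])
    show "open ((U(n := U n \<inter> A)) k)" "g k \<in> (U(n := U n \<inter> A)) k" for k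
      using U AB by auto
    fix h assume h: "\<And>k. k < Suc n \<Longrightarrow> h k \<in> (U(n := U n \<inter> A)) k"
    have "compose_upto h n v \<in> B"
    proof (rule U(3))
      show "h k \<in> U k" if "k < n" for k using h[of k] that by auto
    qed
    moreover have "h n \<in> A" using h[of n] by auto
    ultimately show "compose_upto h (Suc n) v \<in> V" using AB(4) by auto
  qed
qed

lemma measurable_compose_upto [measurable]:
  "(\<lambda>\<omega>. compose_upto (\<lambda>k. fst (\<omega> k)) n v) \<in> (marked_space :: (nat \<Rightarrow> poly_map \<times> 'x) measure) \<rightarrow>\<^sub>M borel"
proof (induction n)
  case (Suc n)
  have "(\<lambda>\<omega> :: nat \<Rightarrow> poly_map \<times> 'x. (fst (\<omega> n), compose_upto (\<lambda>k. fst (\<omega> k)) n v)) \<in> marked_space \<rightarrow>\<^sub>M borel"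
    using measurable_mark(1) Suc by (rule borel_measurable_Pair)
  from measurable_compose[OF this borel_measurable_continuous_onI[OF continuous_on_apply_poly]]
  show ?case by simp
qed simp

context random_polynomial_system
begin

lemma orbit_in_composition_set:
  assumes "\<omega> \<in> Xiw" "1 \<le> n"
  shows "compose_upto (\<lambda>k. fst (\<omega> k)) n \<in> composition_set u P \<tau> w"
proof -
  let ?xs = "map (\<lambda>k. snd (\<omega> k)) [0..<n]"
  have "(\<lambda>k. snd (\<omega> k)) \<in> cyl ?xs" by (simp add: cyl_def)
  then have "?xs \<in> admissible_words u P w n" using assms(1) unfolding Xi_eq by fastforce
  moreover have "\<forall>j<n. fst (\<omega> j) \<in> Gamma_set \<tau> (?xs ! j)" using assms(1) by (simp add: Xi_eq)
  ultimately show ?thesis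
    using assms(2) unfolding composition_set_def by blast
qed

lemma escaping_probability_eq_0:
  assumes "v \<in> smallest_filled_Julia u P \<tau> w"
  shows "escaping_probability u P \<tau> w v = 0"
proof -
  obtain B where B: "bounded B" "(\<lambda>h. h v) ` composition_set u P \<tau> w \<subseteq> Fin ` B"
    using assms by (auto simp: smallest_filled_Julia_def)
  obtain b where b: "\<And>a. a \<in> B \<Longrightarrow> cmod a \<le> b" using B(1) by (auto simp: bounded_iff)
  have "\<not> (\<lambda>n. compose_upto (\<lambda>k. fst (\<omega> k)) n v) \<longlonglongrightarrow> Infty" if \<omega>: "\<omega> \<in> Xiw" for \<omega>
  proof
    assume "(\<lambda>n. compose_upto (\<lambda>k. fst (\<omega> k)) n v) \<longlonglongrightarrow> Infty"
    then have "\<forall>\<^sub>F n in sequentially. compose_upto (\<lambda>k. fst (\<omega> k)) n v \<in> ball Infty (dist Infty (Fin (of_real \<bar>b\<bar>)))"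
      by (rule topological_tendstoD) auto
    then obtain N where N: "\<And>n. N \<le> n \<Longrightarrow>
        compose_upto (\<lambda>k. fst (\<omega> k)) n v \<in> ball Infty (dist Infty (Fin (of_real \<bar>b\<bar>)))"
      by (auto simp: eventually_sequentially)
    \<comment> \<open>\<open>Suc N\<close> rather than \<open>N\<close>, because
      \<open>composition_set\<close> contains only compositions of at least one factor.\<close>
    have "compose_upto (\<lambda>k. fst (\<omega> k)) (Suc N) v \<in> Fin ` B"
      using B(2) orbit_in_composition_set[OF \<omega>, of "Suc N"] by (auto simp del: compose_upto.simps)
    then obtain a where a: "compose_upto (\<lambda>k. fst (\<omega> k)) (Suc N) v = Fin a" "a \<in> B" by auto
    then have "\<bar>b\<bar> < cmod a"
      using N[of "Suc N"] mem_ball_Infty_iff[of "\<bar>b\<bar>"] by (metis abs_ge_zero le_SucI order_refl)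
    then show False using b[OF a(2)] by linarith
  qed
  then have "{\<omega> \<in> Xiw. (\<lambda>n. compose_upto (\<lambda>k. fst (\<omega> k)) n v) \<longlonglongrightarrow> Infty} = {}" by auto
  then show ?thesis by (simp only: escaping_probability_def measure_empty)
qed

lemma escaping_probability_pos:
  assumes comp: "\<And>x. compact (Gamma_set \<tau> x)" and plus: "\<And>x. Gamma_set \<tau> x \<subseteq> Poly_plus"
    and v: "v \<notin> smallest_filled_Julia u P \<tau> w"
  shows "0 < escaping_probability u P \<tau> w v"
proof -
  interpret N: prob_space marked_measure by (rule prob_space_marked_measure)
  \<comment> \<open>The alphabet is finite, so the union is compact and one radius serves all
    letters.\<close>
  have "compact (\<Union>x. Gamma_set \<tau> x)" using comp by auto
  then obtain R where R: "1 \<le> R"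
    "\<And>f z. f \<in> (\<Union>x. Gamma_set \<tau> x) \<Longrightarrow> R \<le> cmod z \<Longrightarrow> 2 * cmod z \<le> cmod (poly (poly_of f) z)"
    using escape_radius[of "\<Union>x. Gamma_set \<tau> x"] plus by (metis UN_least)
  define V where "V = ball Infty (dist Infty (Fin (of_real R)))"
  have [measurable]: "V \<in> sets borel" by (simp add: V_def)
  define E :: "(nat \<Rightarrow> poly_map \<times> 'x) set" where "E = {\<omega>. \<exists>n. compose_upto (\<lambda>k. fst (\<omega> k)) n v \<in> V}"
  \<comment> \<open>Measurability matters: \<open>measure\<close> is 0 on non-measurable sets.\<close>
  have "E = {\<omega> \<in> space marked_space. \<exists>n. compose_upto (\<lambda>k. fst (\<omega> k)) n v \<in> V}" by (simp add: E_def)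
  also have "\<dots> \<in> sets marked_space" by measurable
  finally have E: "E \<in> sets marked_space" .
  have "(\<lambda>n. compose_upto (\<lambda>k. fst (\<omega> k)) n v) \<longlonglongrightarrow> Infty \<longleftrightarrow> \<omega> \<in> E" if "\<omega> \<in> Xiw" for \<omega>
    unfolding E_def V_def mem_Collect_eq
  proof (rule compose_upto_tendsto_Infty_iff[OF R(1)])
    fix n z assume "R \<le> cmod z"
    then show "2 * cmod z \<le> cmod (poly (poly_of (fst (\<omega> n))) z)"
      using that by (intro R(2)) (auto simp: Xi_eq)
  qed
  then have "{\<omega> \<in> Xiw. (\<lambda>n. compose_upto (\<lambda>k. fst (\<omega> k)) n v) \<longlonglongrightarrow> Infty} = Xiw \<inter> E" by auto
  then have esc: "escaping_probability u P \<tau> w v = measure marked_measure E"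
    by (simp add: escaping_probability_def measure_tau_tilde[OF E])
  \<comment> \<open>No bounded set contains all images of \<open>v\<close>, in particular not the
    disc of radius \<open>R\<close>. The image found outside may also be \<open>Infty\<close>, which
    belongs to \<open>V\<close> as well.\<close>
  have "\<not> (\<lambda>h. h v) ` composition_set u P \<tau> w \<subseteq> Fin ` cball 0 R"
    using v bounded_cball unfolding smallest_filled_Julia_def by blast
  then obtain h where h: "h \<in> composition_set u P \<tau> w" "h v \<notin> Fin ` cball 0 R" by blast
  then obtain g n xs where g: "h = compose_upto g n" "xs \<in> admissible_words u P w n"
    "\<And>j. j < n \<Longrightarrow> g j \<in> Gamma_set \<tau> (xs ! j)" by (auto simp: composition_set_def)
  have n: "n = length xs" using g(2) by (simp add: admissible_words_def)
  have "compose_upto g n v \<in> V"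
    unfolding V_def using h(2) R(1) g(1) by (subst mem_ball_Infty_iff) (auto simp: not_le)
  then obtain U where U: "\<And>k. open (U k)" "\<And>k. g k \<in> U k"
    "\<And>h. (\<And>k. k < n \<Longrightarrow> h k \<in> U k) \<Longrightarrow> compose_upto h n v \<in> V"
    using compose_upto_open_box[of V g n v] unfolding V_def by auto
  have "0 < measure marked_measure (marked_cyl xs U)"
  proof (rule measure_marked_cyl_pos[OF g(2) U(1)])
    show "U k \<inter> Gamma_set \<tau> (xs ! k) \<noteq> {}" if "k < n" for k
      using U(2)[of k] g(3)[OF that] by blast
  qed
  also have "\<dots> \<le> measure marked_measure E"
  proof (rule N.finite_measure_mono)
    show "marked_cyl xs U \<subseteq> E"
    proof
      fix \<omega> assume "\<omega> \<in> marked_cyl xs U"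
      then have "compose_upto (\<lambda>k. fst (\<omega> k)) n v \<in> V"
        by (intro U(3)) (simp add: marked_cyl_def n)
      then show "\<omega> \<in> E" by (auto simp: E_def)
    qed
  qed (simp add: E)
  finally show ?thesis by (simp add: esc)
qed

end

theorem mainTheorem2:
  fixes u :: "'w::metric_space \<Rightarrow> 'x::finite \<Rightarrow> 'w"
    and P :: "'w \<Rightarrow> 'x measure"
    and \<tau> :: "'x \<Rightarrow> poly_map measure"
    and w :: 'w
  assumes "polynomial_rscc borel (count_space UNIV) u P \<tau>"
    and "standing_assumptions u P"
    and "\<And>x. compact (Gamma_set \<tau> x)"
    and "\<And>x. Gamma_set \<tau> x \<subseteq> Poly_plus"
  shows "smallest_filled_Julia u P \<tau> w = {z. escaping_probability u P \<tau> w z = 0}"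
proof -
  have P: "P \<in> borel \<rightarrow>\<^sub>M prob_algebra (count_space UNIV)"
    and \<tau>: "\<tau> x \<in> space (prob_algebra borel)" for x
    using assms(1) by (auto simp: polynomial_rscc_def rscc_def)
  have Pv: "P v \<in> space (prob_algebra (count_space UNIV))" for v
    using P by (rule measurable_space) simp
  have ker: "prob_space (P v)" "sets (P v) = UNIV" for v
    using Pv[of v] by (simp_all add: space_prob_algebra)
  have tau: "prob_space (\<tau> x)" "sets (\<tau> x) = sets borel" for x
    using \<tau>[of x] by (simp_all add: space_prob_algebra)
  interpret random_polynomial_system u P \<tau> w
    by (rule random_polynomial_system.intro) (rule ker tau)+
  have "z \<in> smallest_filled_Julia u P \<tau> w \<longleftrightarrow> escaping_probability u P \<tau> w z = 0" for z
    using escaping_probability_eq_0[of z] escaping_probability_pos[OF assms(3,4), of z] by (metis less_irrefl)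
  then show ?thesis by blast
qed

end
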